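(* Let $\phi\in \operatorname{Aut}(\mathbb{A}^2)$ be an automorphism of the affine plane over $\mathbb{C}$ of algebraic degree $d\geq 2$. Then its ample index satisfies $$\alpha(\phi,\mathrm{amp})\leq 0.$$
   Context: The base field is $\mathbb{C}$. $H=\mathbb{P}^2\setminus\mathbb{A}^2$ is the line at infinity. An automorphism $\phi\in\operatorname{Aut}(\mathbb{A}^2)$ is given by two polynomials $P_1,P_2$; its algebraic degree is $\deg(\phi)=\max(\deg P_1,\deg P_2)$ (total degrees). The rational map $\mathbb{P}^2\dashrightarrow\mathbb{P}^2$ induced by $\phi$ is still denoted $\phi$. Resolution: for a smooth projective variety $V$, a birational morphism $\pi:V\to\mathbb{P}^2$ is a resolution of $\phi$, denoted $(\pi,V)$, if $\phi\circ\pi$ and $\phi^{-1}\circ\pi$ are morphisms $V\to\mathbb{P}^2$. For a variety $V$, $\operatorname{Pic}_{\mathbb{R}}(V)$ is the Picard group tensored with $\mathbb{R}$ and $\operatorname{Pic}^{a}_{\mathbb{R}}(V)$ is the (open) cone generated by the classes of ample divisors. For a resolution $(\pi,V)$ of $\phi$ and $\alpha\in\mathbb{R}$, put $$D(\alpha,\pi,V):=(\phi\circ\pi)^*H+(\phi^{-1}\circ\pi)^*H-\alpha\,\pi^*H,$$ $$\alpha_{\max,\mathrm{amp}}(\phi,\pi,V):=\sup\{\alpha\in\mathbb{R}\mid D(\alpha,\pi,V)\in\operatorname{Pic}^{a}_{\mathbb{R}}(V)\}.$$ The ample index of $\phi$ is $$\alpha(\phi,\mathrm{amp}):=\sup\{\alpha_{\max,\mathrm{amp}}(\phi,\pi,V)\mid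 (\pi,V)\text{ a resolution of }\phi\}.$$ *)

theory Defs
  imports
    "HOL-Analysis.Analysis"
    "HOL-Library.Poly_Mapping"
    "HOL-Library.Function_Algebras"
    "HOL-Algebra.Group"
begin

section \<open>Polynomials over the complex numbers\<close>

text \<open>Monomials are exponent functions of finite support on the variables
  \<open>x\<^sub>0, x\<^sub>1, \<dots>\<close>; the multiplication of \<open>mpoly\<close> is the library's convolution product.\<close>

type_synonym mpoly = "(nat \<Rightarrow>\<^sub>0 nat) \<Rightarrow>\<^sub>0 complex"
type_synonym vec = "nat \<Rightarrow> complex"

definition mono_eval :: "(nat \<Rightarrow>\<^sub>0 nat) \<Rightarrow> vec \<Rightarrow> complex" where
  "mono_eval m v = (\<Prod>i\<in>Poly_Mapping.keys m. v i ^ Poly_Mapping.lookup m i)"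

definition mono_degree :: "(nat \<Rightarrow>\<^sub>0 nat) \<Rightarrow> nat" where
  "mono_degree m = (\<Sum>i\<in>Poly_Mapping.keys m. Poly_Mapping.lookup m i)"

definition peval :: "mpoly \<Rightarrow> vec \<Rightarrow> complex" where
  "peval F v = (\<Sum>m\<in>Poly_Mapping.keys F. Poly_Mapping.lookup F m * mono_eval m v)"

definition total_degree :: "mpoly \<Rightarrow> nat" where
  "total_degree F = Max (insert 0 (mono_degree ` Poly_Mapping.keys F))"

definition homogeneous_of :: "nat \<Rightarrow> mpoly \<Rightarrow> bool" where
  "homogeneous_of d F \<longleftrightarrow> (\<forall>m\<in>Poly_Mapping.keys F. mono_degree m = d)"

definition pvars :: "mpoly \<Rightarrow> nat set" where
  "pvars F = (\<Union>m\<in>Poly_Mapping.keys F. Poly_Mapping.keys m)"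

lemma mono_eval_superset:
  assumes "finite A" "Poly_Mapping.keys m \<subseteq> A"
  shows "mono_eval m v = (\<Prod>i\<in>A. v i ^ Poly_Mapping.lookup m i)"
  unfolding mono_eval_def using assms
  by (intro prod.mono_neutral_left) (auto simp: in_keys_iff)

lemma mono_degree_superset:
  assumes "finite A" "Poly_Mapping.keys m \<subseteq> A"
  shows "mono_degree m = (\<Sum>i\<in>A. Poly_Mapping.lookup m i)"
  unfolding mono_degree_def using assms
  by (intro sum.mono_neutral_left) (auto simp: in_keys_iff)

lemma mono_eval_add: "mono_eval (a + b) v = mono_eval a v * mono_eval b v"
proof -
  let ?A = "Poly_Mapping.keys a \<union> Poly_Mapping.keys b"
  have "mono_eval (a + b) v = (\<Prod>i\<in>?A. v i ^ Poly_Mapping.lookup (a + b) i)"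
    by (rule mono_eval_superset) (use keys_add[of a b] in auto)
  also have "\<dots> = mono_eval a v * mono_eval b v"
    by (simp add: mono_eval_superset[of ?A] lookup_add power_add prod.distrib)
  finally show ?thesis .
qed

lemma mono_degree_add: "mono_degree (a + b) = mono_degree a + mono_degree b"
proof -
  let ?A = "Poly_Mapping.keys a \<union> Poly_Mapping.keys b"
  have "mono_degree (a + b) = (\<Sum>i\<in>?A. Poly_Mapping.lookup (a + b) i)"
    by (rule mono_degree_superset) (use keys_add[of a b] in auto)
  also have "\<dots> = mono_degree a + mono_degree b"
    by (simp add: mono_degree_superset[of ?A] lookup_add sum.distrib)
  finally show ?thesis .
qed

lemma peval_superset:
  assumes "finite A" "Poly_Mapping.keys F \<subseteq> A"
  shows "peval F v = (\<Sum>m\<in>A. Poly_Mapping.lookup F m * mono_eval m v)"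
  unfolding peval_def using assms
  by (intro sum.mono_neutral_left) (auto simp: in_keys_iff)

lemma peval_zero [simp]: "peval 0 v = 0"
  by (simp add: peval_def)

lemma peval_add: "peval (F + G) v = peval F v + peval G v"
proof -
  let ?A = "Poly_Mapping.keys F \<union> Poly_Mapping.keys G"
  have "peval (F + G) v = (\<Sum>m\<in>?A. Poly_Mapping.lookup (F + G) m * mono_eval m v)"
    by (rule peval_superset) (use keys_add[of F G] in auto)
  also have "\<dots> = peval F v + peval G v"
    by (simp add: peval_superset[of ?A] lookup_add ring_distribs sum.distrib)
  finally show ?thesis .
qed

lemma peval_single: "peval (Poly_Mapping.single m c) v = c * mono_eval m v"
  by (simp add: peval_def)

lemma mpoly_induct [case_names zero add]:
  fixes F :: mpoly
  assumes "P 0"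
    and "\<And>m c F. P F \<Longrightarrow> P (Poly_Mapping.single m c + F)"
  shows "P F"
proof (induction F rule: update_induct)
  case const
  show ?case by (rule assms(1))
next
  case (update F a b)
  have "Poly_Mapping.update a b F = Poly_Mapping.single a b + F"
    using update(1)
    by (intro poly_mapping_eqI)
       (auto simp: lookup_update lookup_add lookup_single when_def in_keys_iff)
  then show ?case using assms(2)[OF update(3)] by simp
qed

lemma peval_mult: "peval (F * G) v = peval F v * peval G v"
proof -
  have single: "peval (Poly_Mapping.single m c * G) v = c * mono_eval m v * peval G v" for m c
    by (induction G rule: mpoly_induct)
       (simp_all add: ring_distribs peval_add mult_single peval_single mono_eval_add)
  show ?thesis
    by (induction F rule: mpoly_induct) (simp_all add: ring_distribs peval_add single peval_single)
qed

lemma homogeneous_of_mult: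
  assumes "homogeneous_of d F" "homogeneous_of e G"
  shows "homogeneous_of (d + e) (F * G)"
  using keys_mult[of F G] assms unfolding homogeneous_of_def
  by (fastforce simp: mono_degree_add)

lemma peval_scale:
  assumes "homogeneous_of d F"
  shows "peval F (\<lambda>i. c * v i) = c ^ d * peval F v"
proof -
  have mono: "mono_eval m (\<lambda>i. c * v i) = c ^ mono_degree m * mono_eval m v" for m
    by (simp add: mono_eval_def mono_degree_def power_mult_distrib prod.distrib power_sum)
  have "peval F (\<lambda>i. c * v i)
      = (\<Sum>m\<in>Poly_Mapping.keys F. c ^ d * (Poly_Mapping.lookup F m * mono_eval m v))"
    unfolding peval_def mono
    by (rule sum.cong) (use assms in \<open>simp_all add: homogeneous_of_def\<close>)
  then show ?thesis by (simp only: peval_def sum_distrib_left)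
qed


section \<open>Projective space and its Zariski topology\<close>

text \<open>A point of projective space is the set of all its vectors of homogeneous coordinates.
  Extending vectors by zero gives \<open>PS n \<subseteq> PS (n + 1)\<close>; all varieties below lie in some \<open>PS n\<close>
  and carry the topology induced from the union of these spaces. On \<open>PS n\<close> this is the
  usual Zariski topology, since the additional coordinates vanish there.\<close>

type_synonym pt = "vec set"

definition pclass :: "vec \<Rightarrow> pt" where
  "pclass v = {(\<lambda>i. c * v i) | c. c \<noteq> 0}"

definition PS :: "nat \<Rightarrow> pt set" where
  "PS n = {pclass v | v. (\<exists>i. v i \<noteq> 0) \<and> (\<forall>i>n. v i = 0)}"

definition zero_locus :: "mpoly set \<Rightarrow> pt set" where
  "zero_locus S = {p \<in> (\<Union>n. PS n). \<forall>F\<in>S. \<forall>v\<in>p. peval F v = 0}"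

definition zariski :: "pt topology" where
  "zariski = topology (\<lambda>U. \<exists>S. (\<forall>F\<in>S. \<exists>d. homogeneous_of d F) \<and> U = (\<Union>n. PS n) - zero_locus S)"

lemma peval_vanish_pclass:
  assumes "homogeneous_of d F" "v \<in> pclass u" "w \<in> pclass u"
  shows "peval F v = 0 \<longleftrightarrow> peval F w = 0"
  using assms peval_scale[OF assms(1)] by (auto simp: pclass_def)

lemma zero_locus_mult:
  assumes "\<forall>F\<in>S. \<exists>d. homogeneous_of d F" "\<forall>F\<in>T. \<exists>d. homogeneous_of d F"
  shows "zero_locus {F * G | F G. F \<in> S \<and> G \<in> T} = zero_locus S \<union> zero_locus T"
proof (intro equalityI subsetI)
  fix p assume p: "p \<in> zero_locus {F * G | F G. F \<in> S \<and> G \<in> T}"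
  then obtain u where u: "p = pclass u" by (auto simp: zero_locus_def PS_def)
  show "p \<in> zero_locus S \<union> zero_locus T"
  proof (rule ccontr)
    assume "p \<notin> zero_locus S \<union> zero_locus T"
    then obtain F v G w where FG: "F \<in> S" "v \<in> p" "peval F v \<noteq> 0" "G \<in> T" "w \<in> p" "peval G w \<noteq> 0"
      using p by (auto simp: zero_locus_def)
    then have "peval G v \<noteq> 0"
      using assms(2) peval_vanish_pclass u by blast
    then have "peval (F * G) v \<noteq> 0" using FG by (simp add: peval_mult)
    then show False using p FG by (auto simp: zero_locus_def)
  qed
qed (auto simp: zero_locus_def peval_mult)

lemma openin_zariski:
  "openin zariski U \<longleftrightarrow>
    (\<exists>S. (\<forall>F\<in>S. \<exists>d. homogeneous_of d F) \<and> U = (\<Union>n. PS n) - zero_locus S)"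
proof -
  let ?P = "\<Union>n. PS n"
  let ?open = "\<lambda>U. \<exists>S. (\<forall>F\<in>S. \<exists>d. homogeneous_of d F) \<and> U = ?P - zero_locus S"
  have "istopology ?open"
    unfolding istopology_def
  proof (intro conjI allI impI)
    fix U V assume "?open U" "?open V"
    then obtain S T where S: "\<forall>F\<in>S. \<exists>d. homogeneous_of d F" "U = ?P - zero_locus S"
      and T: "\<forall>F\<in>T. \<exists>d. homogeneous_of d F" "V = ?P - zero_locus T" by blast
    have "\<forall>F\<in>{F * G | F G. F \<in> S \<and> G \<in> T}. \<exists>d. homogeneous_of d F"
      using S T homogeneous_of_mult by blast
    moreover have "U \<inter> V = ?P - zero_locus {F * G | F G. F \<in> S \<and> G \<in> T}"
      unfolding zero_locus_mult[OF S(1) T(1)] S(2) T(2) by blast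
    ultimately show "?open (U \<inter> V)" by blast
  next
    fix K assume "\<forall>U\<in>K. ?open U"
    then obtain S where S: "\<forall>U\<in>K. (\<forall>F\<in>S U. \<exists>d. homogeneous_of d F) \<and> U = ?P - zero_locus (S U)"
      by (rule bchoice[THEN exE])
    have "(\<lambda>U. ?P - zero_locus (S U)) ` K = (\<lambda>U. U) ` K"
      by (rule image_cong[OF refl], rule sym) (use S in blast)
    then have "\<Union>K = \<Union> ((\<lambda>U. ?P - zero_locus (S U)) ` K)"
      by (simp only: image_ident)
    also have "\<dots> = ?P - zero_locus (\<Union>U\<in>K. S U)"
      unfolding zero_locus_def by blast
    finally have "\<Union>K = ?P - zero_locus (\<Union>U\<in>K. S U)" .
    moreover have "\<forall>F\<in>(\<Union>U\<in>K. S U). \<exists>d. homogeneous_of d F"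
      using S by blast
    ultimately show "?open (\<Union>K)" by blast
  qed
  then show ?thesis by (simp add: zariski_def)
qed

definition irreducible_space :: "'a topology \<Rightarrow> bool" where
  "irreducible_space T \<longleftrightarrow> topspace T \<noteq> {} \<and>
    (\<forall>A B. closedin T A \<and> closedin T B \<and> A \<union> B = topspace T \<longrightarrow> A = topspace T \<or> B = topspace T)"

definition krull_dim :: "'a topology \<Rightarrow> enat" where
  "krull_dim T = Sup {enat k | k. \<exists>Z :: nat \<Rightarrow> 'a set.
     (\<forall>i\<le>k. closedin T (Z i) \<and> irreducible_space (subtopology T (Z i))) \<and> (\<forall>i<k. Z i \<subset> Z (Suc i))}"


section \<open>Projective varieties and morphisms\<close>

definition projective_variety :: "pt set \<Rightarrow> bool" where
  "projective_variety V \<longleftrightarrow>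
    (\<exists>n. V \<subseteq> PS n) \<and> closedin zariski V \<and> irreducible_space (subtopology zariski V)"

text \<open>The Zariski tangent space of the affine cone over \<open>V\<close> at the nonzero vector \<open>v\<close>.
  Its dimension exceeds that of the tangent space of \<open>V\<close> at the point \<open>pclass v\<close> by one.\<close>

definition cone_tangent_space :: "pt set \<Rightarrow> vec \<Rightarrow> vec set" where
  "cone_tangent_space V v = {w. \<forall>F d. homogeneous_of d F \<and> V \<subseteq> zero_locus {F} \<longrightarrow>
     ((\<lambda>t. peval F (\<lambda>i. v i + t * w i)) has_field_derivative 0) (at 0)}"

abbreviation vec_scale :: "complex \<Rightarrow> vec \<Rightarrow> vec" where
  "vec_scale \<equiv> \<lambda>c v i. c * v i"

lemma vector_space_vec_scale: "vector_space vec_scale"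
  by unfold_locales (auto simp: algebra_simps fun_eq_iff)

definition smooth_projective_variety :: "pt set \<Rightarrow> bool" where
  "smooth_projective_variety V \<longleftrightarrow> projective_variety V \<and>
    (\<forall>p\<in>V. \<forall>v\<in>p. enat (vector_space.dim vec_scale (cone_tangent_space V v))
                     = krull_dim (subtopology zariski V) + 1)"

text \<open>Regular functions and morphisms are defined on arbitrary subsets of projective space;
  they are only used for locally closed ones. Values outside the domain are irrelevant.\<close>

definition regular_on :: "pt set \<Rightarrow> (pt \<Rightarrow> complex) \<Rightarrow> bool" where
  "regular_on U f \<longleftrightarrow> (\<forall>p\<in>U. \<exists>W F G d.
     openin (subtopology zariski U) W \<and> p \<in> W \<and> homogeneous_of d F \<and> homogeneous_of d G \<and>
     (\<forall>q\<in>W. \<forall>v\<in>q. peval G v \<noteq> 0 \<and> f q = peval F v / peval G v))"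

definition morphism :: "pt set \<Rightarrow> pt set \<Rightarrow> (pt \<Rightarrow> pt) \<Rightarrow> bool" where
  "morphism X Y f \<longleftrightarrow> continuous_map (subtopology zariski X) (subtopology zariski Y) f \<and>
    (\<forall>W h. openin (subtopology zariski Y) W \<and> regular_on W h \<longrightarrow>
       regular_on {p \<in> X. f p \<in> W} (h \<circ> f))"

definition isomorphism :: "pt set \<Rightarrow> pt set \<Rightarrow> (pt \<Rightarrow> pt) \<Rightarrow> bool" where
  "isomorphism X Y f \<longleftrightarrow> morphism X Y f \<and>
    (\<exists>g. morphism Y X g \<and> (\<forall>p\<in>X. g (f p) = p) \<and> (\<forall>q\<in>Y. f (g q) = q))"

definition closed_embedding :: "pt set \<Rightarrow> pt set \<Rightarrow> (pt \<Rightarrow> pt) \<Rightarrow> bool" where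
  "closed_embedding X Y f \<longleftrightarrow>
    f ` X \<subseteq> Y \<and> closedin (subtopology zariski Y) (f ` X) \<and> isomorphism X (f ` X) f"

definition birational_morphism :: "pt set \<Rightarrow> pt set \<Rightarrow> (pt \<Rightarrow> pt) \<Rightarrow> bool" where
  "birational_morphism X Y f \<longleftrightarrow> morphism X Y f \<and>
    (\<exists>U W. openin (subtopology zariski X) U \<and> U \<noteq> {} \<and>
           openin (subtopology zariski Y) W \<and> W \<noteq> {} \<and> isomorphism U W f)"


section \<open>Line bundles and the Picard group\<close>

text \<open>A line bundle on \<open>X\<close> is given by trivialising open neighbourhoods \<open>U x\<close> of the points
  \<open>x\<close> of \<open>X\<close> and transition functions \<open>g x y\<close>, regular on \<open>U x \<inter> U y\<close>; local sections are
  related by \<open>s\<^sub>x = g x y * s\<^sub>y\<close>. The cocycle condition makes the \<open>g x y\<close> invertible.\<close>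

type_synonym line_bundle_data = "(pt \<Rightarrow> pt set) \<times> (pt \<Rightarrow> pt \<Rightarrow> pt \<Rightarrow> complex)"

definition line_bundle :: "pt set \<Rightarrow> line_bundle_data \<Rightarrow> bool" where
  "line_bundle X L \<longleftrightarrow> (case L of (U, g) \<Rightarrow>
     (\<forall>x\<in>X. openin (subtopology zariski X) (U x) \<and> x \<in> U x) \<and>
     (\<forall>x\<in>X. \<forall>y\<in>X. regular_on (U x \<inter> U y) (g x y)) \<and>
     (\<forall>x\<in>X. \<forall>p\<in>U x. g x x p = 1) \<and>
     (\<forall>x\<in>X. \<forall>y\<in>X. \<forall>z\<in>X. \<forall>p\<in>U x \<inter> U y \<inter> U z. g x y p * g y z p = g x z p))"

text \<open>An isomorphism \<open>L \<rightarrow> L'\<close> multiplies local sections at \<open>x\<close> by a unit \<open>h x\<close>, defined on a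
  common, possibly smaller, trivialising neighbourhood \<open>W x\<close>.\<close>

definition lb_iso :: "pt set \<Rightarrow> (line_bundle_data \<times> line_bundle_data) set" where
  "lb_iso X = {((U, g), (U', g')). line_bundle X (U, g) \<and> line_bundle X (U', g') \<and>
     (\<exists>W h. (\<forall>x\<in>X. openin (subtopology zariski X) (W x) \<and> x \<in> W x \<and> W x \<subseteq> U x \<inter> U' x \<and>
                    regular_on (W x) (h x) \<and> (\<forall>p\<in>W x. h x p \<noteq> 0)) \<and>
            (\<forall>x\<in>X. \<forall>y\<in>X. \<forall>p\<in>W x \<inter> W y. h x p * g x y p = g' x y p * h y p))}"

definition lb_trivial :: "pt set \<Rightarrow> line_bundle_data" where
  "lb_trivial X = ((\<lambda>x. X), (\<lambda>x y p. 1))"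

fun lb_tensor :: "line_bundle_data \<Rightarrow> line_bundle_data \<Rightarrow> line_bundle_data" where
  "lb_tensor (U, g) (U', g') = ((\<lambda>x. U x \<inter> U' x), (\<lambda>x y p. g x y p * g' x y p))"

fun lb_pullback :: "pt set \<Rightarrow> (pt \<Rightarrow> pt) \<Rightarrow> line_bundle_data \<Rightarrow> line_bundle_data" where
  "lb_pullback X f (U, g) = ((\<lambda>x. {p \<in> X. f p \<in> U (f x)}), (\<lambda>x y p. g (f x) (f y) (f p)))"

definition Pic :: "pt set \<Rightarrow> line_bundle_data set monoid" where
  "Pic X = \<lparr>carrier = {L. line_bundle X L} // lb_iso X,
            monoid.mult = (\<lambda>A B. lb_iso X `` {lb_tensor L M | L M. L \<in> A \<and> M \<in> B}),
            one = lb_iso X `` {lb_trivial X}\<rparr>"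

text \<open>The line bundle \<open>O(H) = O(1)\<close> of a hyperplane \<open>H\<close> in \<open>PS n\<close>. Around \<open>x\<close> the hyperplane
  \<open>z\<^sub>0 = 0\<close> has the local equation \<open>z\<^sub>0 / z\<^sub>i\<close>, where \<open>i = chart x\<close>, on \<open>z\<^sub>i \<noteq> 0\<close>; the transition
  functions \<open>z\<^sub>j / z\<^sub>i\<close> are the quotients of these local equations. They do not depend on the
  chosen hyperplane.\<close>

definition chart :: "pt \<Rightarrow> nat" where
  "chart p = (LEAST i. \<exists>v\<in>p. v i \<noteq> 0)"

definition hyperplane_bundle :: "nat \<Rightarrow> line_bundle_data" where
  "hyperplane_bundle n =
    ((\<lambda>x. {p \<in> PS n. \<forall>v\<in>p. v (chart x) \<noteq> 0}),
     (\<lambda>x y p. let v = (SOME v. v \<in> p) in v (chart y) / v (chart x)))"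

definition pullback_hyperplane_class :: "pt set \<Rightarrow> nat \<Rightarrow> (pt \<Rightarrow> pt) \<Rightarrow> line_bundle_data set" where
  "pullback_hyperplane_class X n f = lb_iso X `` {lb_pullback X f (hyperplane_bundle n)}"

definition very_ample_class :: "pt set \<Rightarrow> line_bundle_data set \<Rightarrow> bool" where
  "very_ample_class X A \<longleftrightarrow> A \<in> carrier (Pic X) \<and>
    (\<exists>n f. closed_embedding X (PS n) f \<and> A = pullback_hyperplane_class X n f)"

definition ample_class :: "pt set \<Rightarrow> line_bundle_data set \<Rightarrow> bool" where
  "ample_class X A \<longleftrightarrow> A \<in> carrier (Pic X) \<and>
    (\<exists>m::nat. m > 0 \<and> very_ample_class X (A [^]\<^bsub>Pic X\<^esub> m))"


section \<open>Tensor product of an abelian group with the reals\<close>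

text \<open>For an abelian group \<open>G\<close>, the real vector space of \<open>G\<close> tensored with the reals is the free
  real vector space on \<open>carrier G\<close> modulo the relations \<open>[a \<otimes> b] - [a] - [b]\<close>.
  Its elements are represented as cosets.\<close>

definition free_scale :: "real \<Rightarrow> ('a \<Rightarrow>\<^sub>0 real) \<Rightarrow> ('a \<Rightarrow>\<^sub>0 real)" where
  "free_scale r = Poly_Mapping.map (\<lambda>c. r * c)"

lemma lookup_free_scale: "Poly_Mapping.lookup (free_scale r v) a = r * Poly_Mapping.lookup v a"
  by (simp add: free_scale_def map.rep_eq when_def)

lemma vector_space_free_scale: "vector_space free_scale"
  by unfold_locales
     (auto intro!: poly_mapping_eqI simp: lookup_free_scale lookup_add algebra_simps)

definition additive_relations :: "('a, 'b) monoid_scheme \<Rightarrow> ('a \<Rightarrow>\<^sub>0 real) set" where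
  "additive_relations G =
    {Poly_Mapping.single (a \<otimes>\<^bsub>G\<^esub> b) 1 - Poly_Mapping.single a 1 - Poly_Mapping.single b 1
      | a b. a \<in> carrier G \<and> b \<in> carrier G}"

definition real_tensor_class :: "('a, 'b) monoid_scheme \<Rightarrow> ('a \<Rightarrow>\<^sub>0 real) \<Rightarrow> ('a \<Rightarrow>\<^sub>0 real) set" where
  "real_tensor_class G v = {w. Poly_Mapping.keys w \<subseteq> carrier G \<and>
     w - v \<in> module.span free_scale (additive_relations G)}"

definition real_tensor :: "('a, 'b) monoid_scheme \<Rightarrow> ('a \<Rightarrow>\<^sub>0 real) set set" where
  "real_tensor G = {real_tensor_class G v | v. Poly_Mapping.keys v \<subseteq> carrier G}"

definition Pic_real :: "pt set \<Rightarrow> (line_bundle_data set \<Rightarrow>\<^sub>0 real) set set" where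
  "Pic_real X = real_tensor (Pic X)"

text \<open>The ample cone consists of the nonempty linear combinations of ample classes with strictly
  positive coefficients.\<close>

definition ample_cone :: "pt set \<Rightarrow> (line_bundle_data set \<Rightarrow>\<^sub>0 real) set set" where
  "ample_cone X = {\<xi> \<in> Pic_real X. \<exists>v. \<xi> = real_tensor_class (Pic X) v \<and> v \<noteq> 0 \<and>
     (\<forall>A\<in>Poly_Mapping.keys v. ample_class X A \<and> Poly_Mapping.lookup v A > 0)}"


section \<open>Automorphisms of the affine plane and the ample index\<close>

type_synonym affine_plane = "complex \<times> complex"

definition polynomial_map :: "mpoly \<times> mpoly \<Rightarrow> affine_plane \<Rightarrow> affine_plane" where
  "polynomial_map P = (\<lambda>(x, y).
     let v = (\<lambda>i. if i = 0 then x else if i = 1 then y else 0) in (peval (fst P) v, peval (snd P) v))"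

definition bivariate_pair :: "mpoly \<times> mpoly \<Rightarrow> bool" where
  "bivariate_pair P \<longleftrightarrow> pvars (fst P) \<subseteq> {0, 1} \<and> pvars (snd P) \<subseteq> {0, 1}"

definition Aut_A2 :: "(mpoly \<times> mpoly) set" where
  "Aut_A2 = {P. bivariate_pair P \<and>
     (\<exists>Q. bivariate_pair Q \<and> polynomial_map Q \<circ> polynomial_map P = id \<and>
          polynomial_map P \<circ> polynomial_map Q = id)}"

definition algebraic_degree :: "mpoly \<times> mpoly \<Rightarrow> nat" where
  "algebraic_degree P = max (total_degree (fst P)) (total_degree (snd P))"

text \<open>The plane is embedded as \<open>(x, y) \<mapsto> (1 : x : y)\<close>; the line at infinity \<open>H\<close> is \<open>z\<^sub>0 = 0\<close>.\<close>

definition affine_point :: "affine_plane \<Rightarrow> pt" where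
  "affine_point = (\<lambda>(x, y). pclass (\<lambda>i. if i = 0 then 1 else if i = 1 then x else if i = 2 then y else 0))"

text \<open>The rational map \<open>\<phi> \<circ> \<pi>\<close> from \<open>V\<close> to \<open>PS 2\<close> is represented on the open set of all \<open>p\<close> with
  \<open>\<pi> p\<close> in the affine plane, which is nonempty for birational \<open>\<pi>\<close>. It is a morphism if some
  morphism \<open>f\<close> on \<open>V\<close> agrees with it there; this \<open>f\<close> is then unique on \<open>V\<close>.\<close>

definition represents_composite ::
    "pt set \<Rightarrow> (affine_plane \<Rightarrow> affine_plane) \<Rightarrow> (pt \<Rightarrow> pt) \<Rightarrow> (pt \<Rightarrow> pt) \<Rightarrow> bool" where
  "represents_composite V \<phi> \<pi> f \<longleftrightarrow> morphism V (PS 2) f \<and>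
    (\<forall>p\<in>V. \<forall>z. \<pi> p = affine_point z \<longrightarrow> f p = affine_point (\<phi> z))"

definition composite_morphism ::
    "pt set \<Rightarrow> (affine_plane \<Rightarrow> affine_plane) \<Rightarrow> (pt \<Rightarrow> pt) \<Rightarrow> pt \<Rightarrow> pt" where
  "composite_morphism V \<phi> \<pi> = (SOME f. represents_composite V \<phi> \<pi> f)"

definition resolution :: "(affine_plane \<Rightarrow> affine_plane) \<Rightarrow> (pt \<Rightarrow> pt) \<Rightarrow> pt set \<Rightarrow> bool" where
  "resolution \<phi> \<pi> V \<longleftrightarrow> smooth_projective_variety V \<and> birational_morphism V (PS 2) \<pi> \<and>
    (\<exists>f. represents_composite V \<phi> \<pi> f) \<and>
    (\<exists>f. represents_composite V (inv_into UNIV \<phi>) \<pi> f)"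

definition D_class ::
    "(affine_plane \<Rightarrow> affine_plane) \<Rightarrow> real \<Rightarrow> (pt \<Rightarrow> pt) \<Rightarrow> pt set
      \<Rightarrow> (line_bundle_data set \<Rightarrow>\<^sub>0 real) set" where
  "D_class \<phi> \<alpha> \<pi> V = real_tensor_class (Pic V)
    (Poly_Mapping.single (pullback_hyperplane_class V 2 (composite_morphism V \<phi> \<pi>)) 1
     + Poly_Mapping.single (pullback_hyperplane_class V 2 (composite_morphism V (inv_into UNIV \<phi>) \<pi>)) 1
     - Poly_Mapping.single (pullback_hyperplane_class V 2 \<pi>) \<alpha>)"

text \<open>Suprema are taken in the extended reals, so that the supremum of the empty set is
  \<open>-\<infinity>\<close>.\<close>

definition alpha_max_amp :: "(affine_plane \<Rightarrow> affine_plane) \<Rightarrow> (pt \<Rightarrow> pt) \<Rightarrow> pt set \<Rightarrow> ereal" where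
  "alpha_max_amp \<phi> \<pi> V = Sup {ereal \<alpha> | \<alpha>. D_class \<phi> \<alpha> \<pi> V \<in> ample_cone V}"

definition ample_index :: "(affine_plane \<Rightarrow> affine_plane) \<Rightarrow> ereal" where
  "ample_index \<phi> = Sup {alpha_max_amp \<phi> \<pi> V | \<pi> V. resolution \<phi> \<pi> V}"

end

theory Submission
  imports Defs
    "HOL-Computational_Algebra.Fundamental_Theorem_Algebra"
    "HOL-Computational_Algebra.Field_as_Ring"
    "HOL-Computational_Algebra.Polynomial_Factorial"
    "HOL-Library.Groups_Big_Fun"
begin

text \<open>For a resolution \<open>\<pi> : V \<rightarrow> PS 2\<close>, intersect \<open>D(\<alpha>, \<pi>, V)\<close> with the strict transform \<open>C\<close> of
  the line at infinity \<open>H\<close>. As \<open>\<phi>\<close> and \<open>\<phi>\<^sup>-\<^sup>1\<close> both contract \<open>H\<close> to a point, the first two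
  summands have degree \<open>0\<close> on \<open>C\<close>, whereas \<open>\<pi>\<^sup>*H\<close> has positive degree. So the degree of
  \<open>D(\<alpha>, \<pi>, V)\<close> on \<open>C\<close> is a negative multiple of \<open>\<alpha>\<close>, and ampleness forces \<open>\<alpha> < 0\<close>.

  No intersection theory is needed: \<open>\<pi>\<^sup>-\<^sup>1\<close> restricted to \<open>H\<close> parametrises \<open>C\<close> by the projective
  line, and the degree of a line bundle along such a curve is the number of zeros minus the number
  of poles of a rational section.

  That \<open>\<phi>\<close> contracts \<open>H\<close> follows from \<open>\<phi>\<^sup>-\<^sup>1 \<circ> \<phi> = id\<close>: the leading forms of \<open>\<phi>\<^sup>-\<^sup>1\<close> vanish on those
  of \<open>\<phi>\<close>, and a nonzero binary form has only finitely many zeros on \<open>H\<close>.\<close>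

section \<open>Rational functions of one complex variable\<close>

text \<open>By \<open>represents_composite\<close>, the morphism extending \<phi> \<circ> \<pi> is
  prescribed only at points over the affine plane, whereas the curve C lies over the line at
  infinity. Its values on C are therefore computed as limits: through a general point (0 : s : 1) of
  H runs the arc of points (u : s : 1), which lie in the affine plane for u \<noteq> 0, and ordinary
  complex limits u -> 0 replace arguments with Zariski density. Along the curve, statements are made
  for cofinitely many parameters s: indeterminacy points, common zeros and points outside a chart
  only exclude finitely many. Constancy of a morphism on C is also meant generically. This is
  enough, because the pullback of O(1) has degree 0 on the curve exactly for generically constant
  morphisms, and positive degree otherwise. The same criterion makes ample classes positive: a
  closed embedding is injective, and the curve itself is not constant because \<pi> separates its
  general points. Of the degree of the inverse automorphism it is enough to know that it is at least
  1; with \<open>d \<ge> 2\<close> this makes the product of the two degrees exceed 1.\<close>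

lemma eventually_cofinite_poly_nonzero:
  fixes p :: "complex poly"
  assumes "p \<noteq> 0"
  shows "\<forall>\<^sub>F s in cofinite. poly p s \<noteq> 0"
  using poly_roots_finite[OF assms] by (simp add: eventually_cofinite)

lemma eventually_cofinite_ex:
  fixes P :: "complex \<Rightarrow> bool"
  assumes "\<forall>\<^sub>F s in cofinite. P s"
  obtains s where "P s"
  using eventually_happens'[OF _ assms] by (auto simp: infinite_UNIV_char_0)

lemma poly_eqI_cofinite:
  fixes p q :: "complex poly"
  assumes "\<forall>\<^sub>F s in cofinite. poly p s = poly q s"
  shows "p = q"
proof (rule ccontr)
  assume "p \<noteq> q"
  then have "\<forall>\<^sub>F s in cofinite. poly (p - q) s \<noteq> 0"
    by (intro eventually_cofinite_poly_nonzero) simp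
  with assms have "\<forall>\<^sub>F s :: complex in cofinite. False"
    by eventually_elim simp
  then show False by (rule eventually_cofinite_ex)
qed

text \<open>Agreement is asked only at cofinitely many points because the functions to be
  represented are regular functions composed with a curve, and their values outside the domain of
  regularity are arbitrary.\<close>

definition ratrep :: "(complex \<Rightarrow> complex) \<Rightarrow> complex poly \<Rightarrow> complex poly \<Rightarrow> bool" where
  "ratrep u p q \<longleftrightarrow> q \<noteq> 0 \<and> (\<forall>\<^sub>F s in cofinite. u s = poly p s / poly q s)"

text \<open>The condition \<open>p \<noteq> 0\<close> excludes the zero function, which has no order
  at a point.\<close>

definition ratfun :: "(complex \<Rightarrow> complex) \<Rightarrow> bool" where
  "ratfun u \<longleftrightarrow> (\<exists>p q. p \<noteq> 0 \<and> ratrep u p q)"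

definition rord :: "complex \<Rightarrow> (complex \<Rightarrow> complex) \<Rightarrow> int" where
  "rord a u = (SOME k. \<exists>p q. p \<noteq> 0 \<and> ratrep u p q \<and>
     k = int (Polynomial.order a p) - int (Polynomial.order a q))"

lemma ratrep_cross:
  assumes "ratrep u p q" "ratrep u p' q'"
  shows "p * q' = p' * q"
proof (rule poly_eqI_cofinite)
  have "\<forall>\<^sub>F s in cofinite. poly q s \<noteq> 0" "\<forall>\<^sub>F s in cofinite. poly q' s \<noteq> 0"
    "\<forall>\<^sub>F s in cofinite. u s = poly p s / poly q s"
    "\<forall>\<^sub>F s in cofinite. u s = poly p' s / poly q' s"
    using assms eventually_cofinite_poly_nonzero by (auto simp: ratrep_def)
  then show "\<forall>\<^sub>F s in cofinite. poly (p * q') s = poly (p' * q) s"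
    by eventually_elim (simp add: field_simps)
qed

text \<open>Two fractions that agree at cofinitely many points have equal cross products, and the
  order of vanishing is additive on products; so the choice made in \<open>rord\<close> is
  immaterial.\<close>

lemma rord_eq:
  assumes "p \<noteq> 0" "ratrep u p q"
  shows "rord a u = int (Polynomial.order a p) - int (Polynomial.order a q)"
proof -
  have "int (Polynomial.order a p') - int (Polynomial.order a q')
      = int (Polynomial.order a p) - int (Polynomial.order a q)"
    if "p' \<noteq> 0" "ratrep u p' q'" for p' q'
  proof -
    have nz: "q \<noteq> 0" "q' \<noteq> 0" using assms that by (auto simp: ratrep_def)
    have "Polynomial.order a (p * q') = Polynomial.order a (p' * q)"
      using ratrep_cross[OF assms(2) that(2)] by simp
    then show ?thesis using nz assms that by (simp add: order_mult)
  qed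
  then show ?thesis
    unfolding rord_def using assms by (intro some_equality) blast+
qed

lemma ratrep_mult:
  assumes "ratrep u p q" "ratrep v p' q'"
  shows "ratrep (\<lambda>s. u s * v s) (p * p') (q * q')"
proof -
  have "\<forall>\<^sub>F s in cofinite. u s = poly p s / poly q s" "\<forall>\<^sub>F s in cofinite. v s = poly p' s / poly q' s"
    using assms by (auto simp: ratrep_def)
  then have "\<forall>\<^sub>F s in cofinite. u s * v s = poly (p * p') s / poly (q * q') s"
    by eventually_elim simp
  then show ?thesis using assms by (simp add: ratrep_def)
qed

lemma ratrep_cong:
  assumes "\<forall>\<^sub>F s in cofinite. u s = v s"
  shows "ratrep u p q \<longleftrightarrow> ratrep v p q"
proof -
  have "(\<forall>\<^sub>F s in cofinite. u s = poly p s / poly q s) \<longleftrightarrow> (\<forall>\<^sub>F s in cofinite. v s = poly p s / poly q s)"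
    by (rule eventually_subst, use assms in eventually_elim) simp
  then show ?thesis by (simp add: ratrep_def)
qed

lemma rord_cong:
  assumes "\<forall>\<^sub>F s in cofinite. u s = v s"
  shows "rord a u = rord a v"
  by (simp add: rord_def ratrep_cong[OF assms])

lemma rord_mult:
  assumes "ratfun u" "ratfun v"
  shows "rord a (\<lambda>s. u s * v s) = rord a u + rord a v"
proof -
  obtain p q p' q' where 1: "p \<noteq> 0" "ratrep u p q" and 2: "p' \<noteq> 0" "ratrep v p' q'"
    using assms by (auto simp: ratfun_def)
  have nz: "q \<noteq> 0" "q' \<noteq> 0" using 1 2 by (auto simp: ratrep_def)
  show ?thesis
    using rord_eq[OF 1] rord_eq[OF 2] rord_eq[OF _ ratrep_mult[OF 1(2) 2(2)]] nz 1 2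
    by (simp add: order_mult)
qed

lemma ratrep_1: "ratrep (\<lambda>s. 1) 1 1"
  by (simp add: ratrep_def)

lemma rord_1: "rord a (\<lambda>s. 1) = 0"
  using rord_eq[OF _ ratrep_1] by simp

section \<open>Counting zeros and poles of a rational function\<close>

lemma finite_order_nonzero:
  fixes p :: "complex poly"
  assumes "p \<noteq> 0"
  shows "finite {a. Polynomial.order a p \<noteq> 0}"
  using poly_roots_finite[OF assms] by (rule finite_subset[rotated]) (use order_root assms in auto)

text \<open>The fundamental theorem of algebra with multiplicities: a root is split off, and the
  linear factor contributes 1 to the sum.\<close>

lemma Sum_any_order:
  fixes p :: "complex poly"
  assumes "p \<noteq> 0"
  shows "Sum_any (\<lambda>a. Polynomial.order a p) = Polynomial.degree p"
  using assms
proof (induction "Polynomial.degree p" arbitrary: p)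
  case 0
  then have "Polynomial.order a p = 0" for a
    using order_degree[of p a] by simp
  then show ?case using 0 by simp
next
  case (Suc n)
  have "\<not> constant (poly p)" using Suc(2) by (simp add: constant_degree)
  then obtain a where "poly p a = 0" using fundamental_theorem_of_algebra by blast
  then obtain q where q: "p = [:-a, 1:] * q" by (auto simp: poly_eq_0_iff_dvd)
  have q0: "q \<noteq> 0" using Suc(3) q by auto
  have "Polynomial.degree p = Suc (Polynomial.degree q)" using q q0 degree_mult_eq[of "[:-a, 1:]" q] by (simp del: mult_pCons_left)
  then have IH: "Sum_any (\<lambda>a. Polynomial.order a q) = Polynomial.degree q"
    using Suc q0 by auto
  have lin: "Polynomial.order x [:-a, 1:] = (if x = a then 1 else 0)" for x
    using order_power_n_n[of a 1] by (auto intro!: order_0I)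
  have "Sum_any (\<lambda>x. Polynomial.order x p)
      = Sum_any (\<lambda>x. Polynomial.order x [:-a, 1:] + Polynomial.order x q)"
    using order_mult[of "[:-a, 1:]" q] q Suc(3) by (simp del: mult_pCons_left)
  also have "\<dots> = Sum_any (\<lambda>x. Polynomial.order x [:-a, 1:]) + Sum_any (\<lambda>x. Polynomial.order x q)"
    using q0 by (intro Sum_any.distrib finite_order_nonzero) auto
  also have "Sum_any (\<lambda>x. Polynomial.order x [:-a, 1:]) = 1"
    unfolding lin using Sum_any.expand_superset[of "{a}" "\<lambda>x. if x = a then 1 else 0 :: nat"] by auto
  finally show ?case using IH \<open>Polynomial.degree p = _\<close> by simp
qed

text \<open>On the projective line a principal divisor has degree 0. The right-hand side is minus
  the order at infinity, the point over which the sum does not run.\<close>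

lemma ratrep_rord:
  assumes "p \<noteq> 0" "ratrep u p q"
  shows "finite {a. rord a u \<noteq> 0}"
    and "Sum_any (\<lambda>a. rord a u) = int (Polynomial.degree p) - int (Polynomial.degree q)"
proof -
  have q: "q \<noteq> 0" using assms by (auto simp: ratrep_def)
  have sub: "{a. rord a u \<noteq> 0} \<subseteq> {a. Polynomial.order a p \<noteq> 0} \<union> {a. Polynomial.order a q \<noteq> 0}"
    using rord_eq[OF assms] by auto
  have fin: "finite ({a. Polynomial.order a p \<noteq> 0} \<union> {a. Polynomial.order a q \<noteq> 0})"
    using finite_order_nonzero q assms by blast
  show "finite {a. rord a u \<noteq> 0}" using finite_subset[OF sub fin] .
  let ?A = "{a. Polynomial.order a p \<noteq> 0} \<union> {a. Polynomial.order a q \<noteq> 0}"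
  have "Sum_any (\<lambda>a. rord a u) = (\<Sum>a\<in>?A. rord a u)"
    by (rule Sum_any.expand_superset[OF fin sub])
  also have "\<dots> = int (\<Sum>a\<in>?A. Polynomial.order a p) - int (\<Sum>a\<in>?A. Polynomial.order a q)"
    using rord_eq[OF assms] by (simp add: sum_subtractf)
  also have "(\<Sum>a\<in>?A. Polynomial.order a p) = Polynomial.degree p"
    unfolding Sum_any_order[OF assms(1), symmetric]
    by (rule Sum_any.expand_superset[OF fin, symmetric]) auto
  also have "(\<Sum>a\<in>?A. Polynomial.order a q) = Polynomial.degree q"
    unfolding Sum_any_order[OF q, symmetric]
    by (rule Sum_any.expand_superset[OF fin, symmetric]) auto
  finally show "Sum_any (\<lambda>a. rord a u) = int (Polynomial.degree p) - int (Polynomial.degree q)" .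
qed

section \<open>Regularity at finite points and at infinity\<close>

text \<open>The value \<open>c\<close> is that of the fraction at \<open>a\<close> and is
  independent of the number \<open>u a\<close>.\<close>

definition rat_at :: "complex \<Rightarrow> (complex \<Rightarrow> complex) \<Rightarrow> complex \<Rightarrow> bool" where
  "rat_at a u c \<longleftrightarrow> (\<exists>p q. ratrep u p q \<and> poly q a \<noteq> 0 \<and> c = poly p a / poly q a)"

text \<open>\<open>D\<close> is a common formal degree: after homogenising both polynomials in
  degree \<open>D\<close>, their values at infinity are the coefficients of index
  \<open>D\<close>.\<close>

definition rat_at_infinity :: "(complex \<Rightarrow> complex) \<Rightarrow> complex \<Rightarrow> bool" where
  "rat_at_infinity u c \<longleftrightarrow> (\<exists>p q D. ratrep u p q \<and> Polynomial.degree p \<le> D \<and> Polynomial.degree q \<le> D \<and>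
     Polynomial.coeff q D \<noteq> 0 \<and> c = Polynomial.coeff p D / Polynomial.coeff q D)"

lemma rat_at_unit:
  assumes "rat_at a u c" "c \<noteq> 0"
  shows "ratfun u" "rord a u = 0"
proof -
  obtain p q where pq: "ratrep u p q" "poly q a \<noteq> 0" "c = poly p a / poly q a"
    using assms by (auto simp: rat_at_def)
  have p: "p \<noteq> 0" "poly p a \<noteq> 0" using pq assms by auto
  then show "ratfun u" using pq by (auto simp: ratfun_def)
  show "rord a u = 0" using rord_eq[OF p(1) pq(1)] p pq by (simp add: order_0I)
qed

lemma rat_at_rord_nonneg:
  assumes "rat_at a u c" "ratfun u"
  shows "rord a u \<ge> 0" "rord a u = 0 \<longleftrightarrow> c \<noteq> 0"
proof -
  obtain p q where pq: "ratrep u p q" "poly q a \<noteq> 0" "c = poly p a / poly q a"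
    using assms by (auto simp: rat_at_def)
  obtain p' q' where pq': "ratrep u p' q'" "p' \<noteq> 0"
    using assms by (auto simp: ratfun_def)
  have p: "p \<noteq> 0" using ratrep_cross[OF pq(1) pq'(1)] pq' pq by auto
  have "rord a u = Polynomial.order a p" using rord_eq[OF p pq(1)] p pq by (simp add: order_0I)
  then show "rord a u \<ge> 0" "rord a u = 0 \<longleftrightarrow> c \<noteq> 0"
    using pq p by (auto simp: order_root)
qed

text \<open>A nonzero finite value at infinity forces numerator and denominator to have the same
  degree, so all zeros and poles are at finite points and cancel in number.\<close>

lemma rat_at_infinity_unit:
  assumes "rat_at_infinity u c" "c \<noteq> 0"
  shows "ratfun u" "finite {a. rord a u \<noteq> 0}" "Sum_any (\<lambda>a. rord a u) = 0"
proof -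
  obtain p q D where pq: "ratrep u p q" "Polynomial.degree p \<le> D" "Polynomial.degree q \<le> D"
    "Polynomial.coeff q D \<noteq> 0" "c = Polynomial.coeff p D / Polynomial.coeff q D"
    using assms by (auto simp: rat_at_infinity_def)
  have p: "p \<noteq> 0" "Polynomial.coeff p D \<noteq> 0" using pq assms by auto
  have "Polynomial.degree p = D" "Polynomial.degree q = D"
    using p pq le_degree by (metis le_antisym)+
  then show "ratfun u" "finite {a. rord a u \<noteq> 0}" "Sum_any (\<lambda>a. rord a u) = 0"
    using pq p ratrep_rord[OF p(1) pq(1)] by (auto simp: ratfun_def)
qed

text \<open>A function regular on the whole projective line is constant. In lowest terms, regularity
  at every finite point leaves a denominator without roots, hence a constant one; regularity at
  infinity then bounds the degree of the numerator by 0.\<close>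

lemma rat_at_everywhere_constant:
  assumes "\<And>a. \<exists>c. rat_at a u c" and "rat_at_infinity u c"
  shows "\<exists>k. \<forall>\<^sub>F s in cofinite. u s = k"
proof -
  obtain p q where pq: "ratrep u p q" "coprime p q"
  proof -
    obtain p q where *: "ratrep u p q"
      using assms(1)[of 0] by (auto simp: rat_at_def)
    define g where "g = gcd p q"
    have q: "q \<noteq> 0" using * by (auto simp: ratrep_def)
    then have g: "g \<noteq> 0" by (auto simp: g_def)
    obtain p' q' where d: "p = p' * g" "q = q' * g" "coprime p' q'"
      using gcd_coprime_exists[of p q] g unfolding g_def by auto
    have "\<forall>\<^sub>F s in cofinite. u s = poly p s / poly q s" using * by (simp add: ratrep_def)
    with eventually_cofinite_poly_nonzero[OF g]
    have "\<forall>\<^sub>F s in cofinite. u s = poly p' s / poly q' s"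
      by eventually_elim (simp add: d)
    then have "ratrep u p' q'" using q d by (auto simp: ratrep_def)
    with d show ?thesis using that by blast
  qed
  have q: "q \<noteq> 0" using pq by (auto simp: ratrep_def)
  have "poly q a \<noteq> 0" for a
  proof
    assume qa: "poly q a = 0"
    obtain p' q' where *: "ratrep u p' q'" "poly q' a \<noteq> 0"
      using assms(1)[of a] by (auto simp: rat_at_def)
    have "poly (p * q') a = poly (p' * q) a" using ratrep_cross[OF pq(1) *(1)] by simp
    then have "poly p a = 0" using qa * by simp
    then have "[:-a, 1:] dvd p" "[:-a, 1:] dvd q" using qa by (auto simp: poly_eq_0_iff_dvd)
    then have "is_unit [:-a, 1:]" using pq(2) coprime_common_divisor by blast
    then show False by (simp add: is_unit_iff_degree)
  qed
  then have dq: "Polynomial.degree q = 0"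
    using fundamental_theorem_of_algebra[of q] constant_degree by blast
  obtain p' q' D where *: "ratrep u p' q'" "Polynomial.degree p' \<le> D" "Polynomial.degree q' \<le> D"
    "Polynomial.coeff q' D \<noteq> 0"
    using assms(2) by (auto simp: rat_at_infinity_def)
  have q': "q' \<noteq> 0" "Polynomial.degree q' = D" using * le_degree[of q' D] by auto
  \<comment> \<open>The cross product equals \<open>p' * q\<close> with \<open>q\<close> constant,
    while \<open>q'\<close> already has degree \<open>D\<close>; nothing is left for
    \<open>p\<close>.\<close>
  have "Polynomial.degree (p * q') \<le> D"
    using ratrep_cross[OF pq(1) *(1)] degree_mult_le[of p' q] dq * by simp
  then have dp: "Polynomial.degree p = 0"
    using q' by (cases "p = 0") (auto simp: degree_mult_eq)
  obtain x y where xy: "p = [:x:]" "q = [:y:]" using dp dq degree_eq_zeroE by metis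
  then show ?thesis using pq(1) by (auto simp: ratrep_def)
qed

section \<open>Zariski neighbourhoods\<close>

definition all_points :: "pt set" where
  "all_points = (\<Union>n. PS n)"

lemma PS_subset_all_points: "PS n \<subseteq> all_points"
  by (auto simp: all_points_def)

lemma zero_locus_eq: "zero_locus S = {p \<in> all_points. \<forall>F\<in>S. \<forall>v\<in>p. peval F v = 0}"
  by (simp add: zero_locus_def all_points_def)

lemma openin_zariski_iff:
  "openin zariski U \<longleftrightarrow> (\<exists>S. (\<forall>F\<in>S. \<exists>d. homogeneous_of d F) \<and> U = all_points - zero_locus S)"
  by (simp add: openin_zariski all_points_def)

lemma mem_pclass_iff: "w \<in> pclass v \<longleftrightarrow> (\<exists>c. c \<noteq> 0 \<and> w = (\<lambda>i. c * v i))"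
  by (auto simp: pclass_def)

lemma pclass_self [simp]: "v \<in> pclass v"
  unfolding mem_pclass_iff by (rule exI[of _ 1]) simp

lemma pclass_eqI:
  assumes "w \<in> pclass v"
  shows "pclass w = pclass v"
proof -
  obtain c where c: "c \<noteq> 0" "w = (\<lambda>i. c * v i)" using assms by (auto simp: mem_pclass_iff)
  have "x \<in> pclass w \<longleftrightarrow> x \<in> pclass v" for x
  proof
    assume "x \<in> pclass w"
    then obtain b where "b \<noteq> 0" "x = (\<lambda>i. b * w i)" by (auto simp: mem_pclass_iff)
    then show "x \<in> pclass v"
      unfolding mem_pclass_iff using c by (intro exI[of _ "b * c"]) (auto simp: mult.assoc)
  next
    assume "x \<in> pclass v"
    then obtain b where "b \<noteq> 0" "x = (\<lambda>i. b * v i)" by (auto simp: mem_pclass_iff)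
    then show "x \<in> pclass w"
      unfolding mem_pclass_iff using c by (intro exI[of _ "b / c"]) auto
  qed
  then show ?thesis by blast
qed

lemma pclass_scale: "c \<noteq> 0 \<Longrightarrow> pclass (\<lambda>i. c * v i) = pclass v"
  by (rule pclass_eqI) (auto simp: mem_pclass_iff)

lemma pclass_zero_iff:
  assumes "w \<in> pclass v"
  shows "w i = 0 \<longleftrightarrow> v i = 0"
  using assms by (auto simp: mem_pclass_iff)

lemma PS_D:
  assumes "p \<in> PS n" "v \<in> p"
  shows "p = pclass v" "\<exists>i. v i \<noteq> 0" "\<And>i. i > n \<Longrightarrow> v i = 0"
proof -
  obtain u where u: "p = pclass u" "\<exists>i. u i \<noteq> 0" "\<forall>i>n. u i = 0"
    using assms by (auto simp: PS_def)
  show "p = pclass v" using pclass_eqI u assms by blast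
  show "\<exists>i. v i \<noteq> 0" "\<And>i. i > n \<Longrightarrow> v i = 0" using pclass_zero_iff u assms by blast+
qed

lemma PS_I: "\<exists>i. v i \<noteq> 0 \<Longrightarrow> (\<And>i. i > n \<Longrightarrow> v i = 0) \<Longrightarrow> pclass v \<in> PS n"
  by (auto simp: PS_def)

lemma all_points_D:
  assumes "p \<in> all_points"
  shows "\<exists>v. v \<in> p" and "v \<in> p \<Longrightarrow> p = pclass v" and "v \<in> p \<Longrightarrow> \<exists>i. v i \<noteq> 0"
proof -
  obtain n where n: "p \<in> PS n" using assms by (auto simp: all_points_def)
  then obtain u where "p = pclass u" unfolding PS_def by fast
  then show "\<exists>v. v \<in> p" using pclass_self by blast
  show "p = pclass v" if "v \<in> p" using PS_D(1)[OF n that] .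
  show "\<exists>i. v i \<noteq> 0" if "v \<in> p" using PS_D(2)[OF n that] .
qed

lemma peval_one: "peval 1 v = 1"
  by (simp add: peval_def mono_eval_def one_poly_mapping.rep_eq)

lemma homogeneous_of_one: "homogeneous_of 0 1"
  by (simp add: homogeneous_of_def mono_degree_def)

lemma topspace_zariski: "topspace zariski = all_points"
proof -
  have "p \<notin> zero_locus {1}" if "p \<in> all_points" for p
    using all_points_D(1)[OF that] by (auto simp: zero_locus_eq peval_one)
  then have "openin zariski all_points"
    unfolding openin_zariski_iff using homogeneous_of_one by (intro exI[of _ "{1}"]) blast
  moreover have "U \<subseteq> all_points" if "openin zariski U" for U
    using that unfolding openin_zariski_iff by blast
  ultimately show ?thesis unfolding topspace_def by blast
qed

lemma topspace_subtopology_zariski: "X \<subseteq> all_points \<Longrightarrow> topspace (subtopology zariski X) = X"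
  by (auto simp: topspace_zariski)

definition nonvanishing :: "mpoly \<Rightarrow> pt set" where
  "nonvanishing K = {p. \<forall>v\<in>p. peval K v \<noteq> 0}"

lemma nonvanishing_pclass:
  assumes "homogeneous_of d K"
  shows "pclass v \<in> nonvanishing K \<longleftrightarrow> peval K v \<noteq> 0"
  unfolding nonvanishing_def using peval_vanish_pclass[OF assms _ pclass_self] pclass_self by blast

lemma zero_locus_iff:
  assumes F: "homogeneous_of d F" "F \<in> S" and p: "p \<in> zero_locus S"
  shows "p \<notin> nonvanishing F"
proof -
  have "p \<in> all_points" "\<forall>v\<in>p. peval F v = 0" using p F(2) by (simp_all add: zero_locus_eq)
  then show ?thesis using all_points_D(1)[of p] unfolding nonvanishing_def by fast
qed

lemma not_in_zero_locus:
  assumes p: "p \<in> all_points" "p \<notin> zero_locus S"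
  obtains F where "F \<in> S" "\<And>d. homogeneous_of d F \<Longrightarrow> p \<in> nonvanishing F"
proof -
  have "\<not> (\<forall>F\<in>S. \<forall>v\<in>p. peval F v = 0)" using p by (simp add: zero_locus_eq)
  then obtain F v where F: "F \<in> S" "v \<in> p" "peval F v \<noteq> 0" by fast
  have "p \<in> nonvanishing F" if "homogeneous_of d F" for d
    using nonvanishing_pclass[OF that, of v] all_points_D(2)[OF p(1) F(2)] F(3) by simp
  with F(1) show ?thesis using that by fast
qed

lemma openin_nonvanishing:
  assumes "homogeneous_of d K" "X \<subseteq> all_points"
  shows "openin (subtopology zariski X) (X \<inter> nonvanishing K)"
proof -
  have "openin zariski (all_points - zero_locus {K})"
    unfolding openin_zariski_iff using assms(1) by (intro exI[of _ "{K}"]) fast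
  moreover have "X \<inter> nonvanishing K = (all_points - zero_locus {K}) \<inter> X"
  proof (rule Set.set_eqI)
    fix p
    show "p \<in> X \<inter> nonvanishing K \<longleftrightarrow> p \<in> (all_points - zero_locus {K}) \<inter> X"
      using zero_locus_iff[OF assms(1), of "{K}" p] not_in_zero_locus[of p "{K}"] assms
      by (cases "p \<in> X") auto
  qed
  ultimately show ?thesis unfolding openin_subtopology by fast
qed

text \<open>Neighbourhoods are restricted to basic open sets, given by one form \<open>K\<close>:
  substituting a parametrised curve into \<open>K\<close> turns such a neighbourhood into the
  complement of the roots of one polynomial.\<close>

definition near :: "pt set \<Rightarrow> pt \<Rightarrow> (pt \<Rightarrow> bool) \<Rightarrow> bool" where
  "near X x P \<longleftrightarrow> (\<exists>K d. homogeneous_of d K \<and> x \<in> nonvanishing K \<and> (\<forall>q\<in>X \<inter> nonvanishing K. P q))"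

lemma near_mono: "near X x P \<Longrightarrow> (\<And>q. q \<in> X \<Longrightarrow> P q \<Longrightarrow> Q q) \<Longrightarrow> near X x Q"
  unfolding near_def by blast

lemma near_conj:
  assumes "near X x P" "near X x Q"
  shows "near X x (\<lambda>q. P q \<and> Q q)"
proof -
  obtain K d where K: "homogeneous_of d K" "x \<in> nonvanishing K" "\<forall>q\<in>X \<inter> nonvanishing K. P q"
    using assms(1) unfolding near_def by blast
  obtain K' d' where K': "homogeneous_of d' K'" "x \<in> nonvanishing K'" "\<forall>q\<in>X \<inter> nonvanishing K'. Q q"
    using assms(2) unfolding near_def by blast
  have "nonvanishing (K * K') = nonvanishing K \<inter> nonvanishing K'"
    by (auto simp: nonvanishing_def peval_mult)
  then show ?thesis
    unfolding near_def using K K' homogeneous_of_mult[OF K(1) K'(1)]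
    by (intro exI[of _ "K * K'"] exI[of _ "d + d'"]) auto
qed

lemma near_all_le:
  fixes n :: nat
  assumes "\<And>j. j \<le> n \<Longrightarrow> near X x (P j)"
  shows "near X x (\<lambda>q. \<forall>j\<le>n. P j q)"
  using assms
proof (induction n)
  case (Suc n)
  then have "near X x (\<lambda>q. (\<forall>j\<le>n. P j q) \<and> P (Suc n) q)" by (intro near_conj) auto
  then show ?case by (rule near_mono) (auto simp: le_Suc_eq)
qed auto

lemma near_openin:
  assumes X: "X \<subseteq> all_points" and W: "openin (subtopology zariski X) W" "x \<in> W"
  shows "near X x (\<lambda>q. q \<in> W)"
proof -
  obtain S where S: "\<forall>F\<in>S. \<exists>d. homogeneous_of d F" "W = (all_points - zero_locus S) \<inter> X"
    using W(1) unfolding openin_subtopology openin_zariski_iff by fast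
  have "x \<in> all_points" "x \<notin> zero_locus S" using W(2) S(2) by blast+
  then obtain F where F: "F \<in> S" "\<And>d. homogeneous_of d F \<Longrightarrow> x \<in> nonvanishing F"
    using not_in_zero_locus by metis
  obtain d where d: "homogeneous_of d F" using F(1) S(1) by fast
  have "q \<in> W" if "q \<in> X \<inter> nonvanishing F" for q
    using zero_locus_iff[OF d F(1), of q] that X unfolding S(2) by blast
  then show ?thesis unfolding near_def using d F(2)[OF d] by fast
qed

lemma near_subset:
  assumes "near W x P" "near X x (\<lambda>q. q \<in> W)"
  shows "near X x P"
proof -
  have "near X x (\<lambda>q. q \<in> W \<longrightarrow> P q)" using assms(1) unfolding near_def by blast
  from near_conj[OF this assms(2)] show ?thesis by (rule near_mono) blast
qed

section \<open>Coordinate functions and morphisms\<close>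

definition pvar :: "nat \<Rightarrow> mpoly" where
  "pvar i = Poly_Mapping.single (Poly_Mapping.single i 1) 1"

lemma peval_pvar [simp]: "peval (pvar i) v = v i"
  by (simp add: pvar_def peval_single mono_eval_def)

lemma homogeneous_of_pvar: "homogeneous_of 1 (pvar i)"
  by (simp add: homogeneous_of_def pvar_def mono_degree_def)

text \<open>The body copies the transition functions of \<open>hyperplane_bundle\<close>, so that
  pullbacks of that bundle unfold to coordinate ratios.\<close>

definition coord_ratio :: "nat \<Rightarrow> nat \<Rightarrow> pt \<Rightarrow> complex" where
  "coord_ratio i j p = (let v = (SOME v. v \<in> p) in v j / v i)"

lemma coord_ratio_eq:
  assumes "p \<in> all_points" "v \<in> p"
  shows "coord_ratio i j p = v j / v i"
proof -
  have "(SOME v. v \<in> p) \<in> p" using someI[of "\<lambda>v. v \<in> p"] assms(2) by simp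
  then have "(SOME v. v \<in> p) \<in> pclass v" using all_points_D(2)[OF assms] by simp
  then show ?thesis by (auto simp: mem_pclass_iff coord_ratio_def)
qed

lemma openin_coord_nonzero:
  assumes "X \<subseteq> all_points"
  shows "openin (subtopology zariski X) {p \<in> X. \<forall>v\<in>p. v i \<noteq> 0}"
proof -
  have "{p \<in> X. \<forall>v\<in>p. v i \<noteq> 0} = X \<inter> nonvanishing (pvar i)"
    by (auto simp: nonvanishing_def)
  then show ?thesis using openin_nonvanishing[OF homogeneous_of_pvar assms] by simp
qed

lemma regular_on_coord_ratio:
  assumes "X \<subseteq> all_points" "\<And>p v. p \<in> X \<Longrightarrow> v \<in> p \<Longrightarrow> v i \<noteq> 0"
  shows "regular_on X (coord_ratio i j)"
  unfolding regular_on_def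
proof
  fix p assume "p \<in> X"
  moreover have "openin (subtopology zariski X) X"
    using openin_topspace[of "subtopology zariski X"] topspace_subtopology_zariski[OF assms(1)] by simp
  moreover have "\<forall>q\<in>X. \<forall>v\<in>q. peval (pvar i) v \<noteq> 0 \<and>
      coord_ratio i j q = peval (pvar j) v / peval (pvar i) v"
    using assms coord_ratio_eq by (simp add: subset_iff)
  ultimately show "\<exists>W F G d. openin (subtopology zariski X) W \<and> p \<in> W \<and> homogeneous_of d F \<and>
      homogeneous_of d G \<and> (\<forall>q\<in>W. \<forall>v\<in>q. peval G v \<noteq> 0 \<and> coord_ratio i j q = peval F v / peval G v)"
    using homogeneous_of_pvar by blast
qed

lemma regular_on_near:
  assumes "regular_on U f" "x \<in> U" "U \<subseteq> all_points"
  shows "\<exists>F G d. homogeneous_of d F \<and> homogeneous_of d G \<and>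
    near U x (\<lambda>q. \<forall>v\<in>q. peval G v \<noteq> 0 \<and> f q = peval F v / peval G v)"
proof -
  obtain W F G d where *: "openin (subtopology zariski U) W" "x \<in> W"
    "homogeneous_of d F" "homogeneous_of d G"
    "\<forall>q\<in>W. \<forall>v\<in>q. peval G v \<noteq> 0 \<and> f q = peval F v / peval G v"
    using bspec[OF assms(1)[unfolded regular_on_def] assms(2)] by (elim exE conjE)
  have "near U x (\<lambda>q. \<forall>v\<in>q. peval G v \<noteq> 0 \<and> f q = peval F v / peval G v)"
    by (rule near_mono[OF near_openin[OF assms(3) *(1,2)]]) (use *(5) in simp)
  then show ?thesis using *(3,4) by (intro exI conjI)
qed

lemma morphism_image:
  assumes "morphism X Y f" "X \<subseteq> all_points" "Y \<subseteq> all_points" "p \<in> X"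
  shows "f p \<in> Y"
  using continuous_map_image_subset_topspace[of "subtopology zariski X" "subtopology zariski Y" f]
    assms(1,4) unfolding morphism_def topspace_subtopology_zariski[OF assms(2)]
    topspace_subtopology_zariski[OF assms(3)] by blast

lemma morphism_openin:
  assumes "morphism X Y f" "X \<subseteq> all_points" "openin (subtopology zariski Y) W"
  shows "openin (subtopology zariski X) {p \<in> X. f p \<in> W}"
  using openin_continuous_map_preimage[of "subtopology zariski X" "subtopology zariski Y" f W] assms(1,3)
  unfolding morphism_def topspace_subtopology_zariski[OF assms(2)] by blast

text \<open>Morphisms are defined by pulling back regular functions; this is the instance for the
  affine coordinates of the chart where coordinate \<open>i\<close> is nonzero.\<close>

lemma morphism_coord_regular:
  assumes "morphism X Y f" "X \<subseteq> all_points" "Y \<subseteq> all_points"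
  shows "regular_on {p \<in> X. \<forall>w\<in>f p. w i \<noteq> 0} (\<lambda>p. coord_ratio i j (f p))"
proof -
  let ?O = "{q \<in> Y. \<forall>v\<in>q. v i \<noteq> 0}"
  have "regular_on ?O (coord_ratio i j)"
    using assms(3) by (intro regular_on_coord_ratio) auto
  then have "regular_on {p \<in> X. f p \<in> ?O} (coord_ratio i j \<circ> f)"
    using assms openin_coord_nonzero[OF assms(3)] unfolding morphism_def by blast
  moreover have "{p \<in> X. f p \<in> ?O} = {p \<in> X. \<forall>w\<in>f p. w i \<noteq> 0}"
    using morphism_image[OF assms] by blast
  ultimately show ?thesis by (simp add: comp_def)
qed

lemma morphism_coord_openin:
  assumes "morphism X Y f" "X \<subseteq> all_points" "Y \<subseteq> all_points"
  shows "openin (subtopology zariski X) {p \<in> X. \<forall>w\<in>f p. w i \<noteq> 0}"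
proof -
  have "{p \<in> X. f p \<in> {q \<in> Y. \<forall>v\<in>q. v i \<noteq> 0}} = {p \<in> X. \<forall>w\<in>f p. w i \<noteq> 0}"
    using morphism_image[OF assms] by blast
  then show ?thesis using morphism_openin[OF assms(1,2) openin_coord_nonzero[OF assms(3), of i]] by simp
qed

text \<open>Each coordinate ratio of \<open>f\<close> is locally a quotient of forms of equal
  degree. The bound \<open>n\<close> keeps the number of ratios finite, so that the individual
  neighbourhoods can be intersected into one.\<close>

lemma morphism_near:
  assumes f: "morphism X Y f" "X \<subseteq> all_points" "Y \<subseteq> all_points"
    and x: "x \<in> X" "w \<in> f x" "w i \<noteq> 0"
  shows "\<exists>F G \<delta>. (\<forall>j. homogeneous_of (\<delta> j) (F j) \<and> homogeneous_of (\<delta> j) (G j)) \<and>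
    near X x (\<lambda>q. (\<forall>w\<in>f q. w i \<noteq> 0) \<and>
      (\<forall>j\<le>n::nat. \<forall>v\<in>q. peval (G j) v \<noteq> 0 \<and> (\<forall>w\<in>f q. w j / w i = peval (F j) v / peval (G j) v)))"
proof -
  let ?U = "{p \<in> X. \<forall>w\<in>f p. w i \<noteq> 0}"
  have fx: "f x \<in> all_points" using morphism_image[OF f x(1)] f(3) by blast
  have xU: "x \<in> ?U"
    using x pclass_zero_iff all_points_D(2)[OF fx x(2)] by auto
  have nU: "near X x (\<lambda>q. q \<in> ?U)"
    by (rule near_openin[OF f(2) morphism_coord_openin[OF f] xU])
  have "\<forall>j. \<exists>F G d. homogeneous_of d F \<and> homogeneous_of d G \<and>
    near ?U x (\<lambda>q. \<forall>v\<in>q. peval G v \<noteq> 0 \<and> coord_ratio i j (f q) = peval F v / peval G v)"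
    using regular_on_near[OF morphism_coord_regular[OF f] xU] f(2) by blast
  then obtain F where "\<forall>j. \<exists>G d. homogeneous_of d (F j) \<and> homogeneous_of d G \<and>
    near ?U x (\<lambda>q. \<forall>v\<in>q. peval G v \<noteq> 0 \<and> coord_ratio i j (f q) = peval (F j) v / peval G v)"
    unfolding choice_iff by blast
  then obtain G where "\<forall>j. \<exists>d. homogeneous_of d (F j) \<and> homogeneous_of d (G j) \<and>
    near ?U x (\<lambda>q. \<forall>v\<in>q. peval (G j) v \<noteq> 0 \<and> coord_ratio i j (f q) = peval (F j) v / peval (G j) v)"
    unfolding choice_iff by blast
  then obtain \<delta> where *: "\<forall>j. homogeneous_of (\<delta> j) (F j) \<and> homogeneous_of (\<delta> j) (G j) \<and>
    near ?U x (\<lambda>q. \<forall>v\<in>q. peval (G j) v \<noteq> 0 \<and> coord_ratio i j (f q) = peval (F j) v / peval (G j) v)"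
    unfolding choice_iff by blast
  have "near X x (\<lambda>q. \<forall>j\<le>n. \<forall>v\<in>q. peval (G j) v \<noteq> 0 \<and> coord_ratio i j (f q) = peval (F j) v / peval (G j) v)"
    by (intro near_all_le near_subset[OF _ nU]) (use * in blast)
  from near_conj[OF nU this]
  have "near X x (\<lambda>q. (\<forall>w\<in>f q. w i \<noteq> 0) \<and>
      (\<forall>j\<le>n. \<forall>v\<in>q. peval (G j) v \<noteq> 0 \<and> (\<forall>w\<in>f q. w j / w i = peval (F j) v / peval (G j) v)))"
  proof (rule near_mono)
    fix q assume q: "q \<in> X" and P: "q \<in> ?U \<and> (\<forall>j\<le>n. \<forall>v\<in>q. peval (G j) v \<noteq> 0 \<and>
      coord_ratio i j (f q) = peval (F j) v / peval (G j) v)"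
    have "f q \<in> all_points" using morphism_image[OF f q] f(3) by blast
    then have c: "w j / w i = coord_ratio i j (f q)" if "w \<in> f q" for w j
      using coord_ratio_eq that by simp
    show "(\<forall>w\<in>f q. w i \<noteq> 0) \<and>
      (\<forall>j\<le>n. \<forall>v\<in>q. peval (G j) v \<noteq> 0 \<and> (\<forall>w\<in>f q. w j / w i = peval (F j) v / peval (G j) v))"
    proof (intro conjI allI impI ballI)
      show "w i \<noteq> 0" if "w \<in> f q" for w using P that by simp
      show "peval (G j) v \<noteq> 0" if "j \<le> n" "v \<in> q" for j v using P that by simp
      show "w j / w i = peval (F j) v / peval (G j) v" if "j \<le> n" "v \<in> q" "w \<in> f q" for j v w
        unfolding c[OF that(3)] using P that by simp
    qed
  qed
  then show ?thesis using * by (intro exI[of _ F] exI[of _ G] exI[of _ \<delta>]) simp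
qed

section \<open>Rational curves\<close>

definition subst_poly :: "(nat \<Rightarrow> complex poly) \<Rightarrow> mpoly \<Rightarrow> complex poly" where
  "subst_poly p F = (\<Sum>m\<in>Poly_Mapping.keys F. Polynomial.smult (Poly_Mapping.lookup F m)
     (\<Prod>i\<in>Poly_Mapping.keys m. p i ^ Poly_Mapping.lookup m i))"

lemma poly_subst_poly: "poly (subst_poly p F) s = peval F (\<lambda>i. poly (p i) s)"
  by (simp add: subst_poly_def peval_def mono_eval_def poly_sum poly_prod)

section \<open>Polynomials with a formal degree bound\<close>

lemma coeff_mult_le:
  fixes p q :: "complex poly"
  assumes "Polynomial.degree p \<le> m" "Polynomial.degree q \<le> n"
  shows "Polynomial.coeff (p * q) (m + n) = Polynomial.coeff p m * Polynomial.coeff q n"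
proof (cases "Polynomial.degree p = m \<and> Polynomial.degree q = n")
  case True
  then show ?thesis using coeff_mult_degree_sum[of p q] by auto
next
  case False
  then have "Polynomial.degree (p * q) < m + n"
    using degree_mult_le[of p q] assms by linarith
  moreover have "Polynomial.coeff p m = 0 \<or> Polynomial.coeff q n = 0"
    using False assms by (metis coeff_eq_0 le_neq_implies_less)
  ultimately show ?thesis by (auto simp: coeff_eq_0)
qed

lemma degree_coeff_power_le:
  fixes p :: "complex poly"
  assumes "Polynomial.degree p \<le> e"
  shows "Polynomial.degree (p ^ l) \<le> l * e \<and> Polynomial.coeff (p ^ l) (l * e) = Polynomial.coeff p e ^ l"
proof (induction l)
  case (Suc l)
  have "Polynomial.coeff (p * p ^ l) (e + l * e) = Polynomial.coeff p e * Polynomial.coeff (p ^ l) (l * e)"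
    using Suc assms by (intro coeff_mult_le) auto
  then show ?case using degree_mult_le[of p "p ^ l"] assms Suc by auto
qed auto

lemma degree_coeff_prod_le:
  fixes p :: "nat \<Rightarrow> complex poly"
  assumes "\<And>i. Polynomial.degree (p i) \<le> e" "finite A"
  shows "Polynomial.degree (\<Prod>i\<in>A. p i ^ l i) \<le> (\<Sum>i\<in>A. l i) * e \<and>
    Polynomial.coeff (\<Prod>i\<in>A. p i ^ l i) ((\<Sum>i\<in>A. l i) * e) = (\<Prod>i\<in>A. Polynomial.coeff (p i) e ^ l i)"
  using assms(2)
proof (induction A)
  case (insert a A)
  note a = degree_coeff_power_le[OF assms(1)[of a], of "l a"]
  have "Polynomial.coeff (p a ^ l a * (\<Prod>i\<in>A. p i ^ l i)) (l a * e + (\<Sum>i\<in>A. l i) * e)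
      = Polynomial.coeff (p a) e ^ l a * (\<Prod>i\<in>A. Polynomial.coeff (p i) e ^ l i)"
    using insert a by (subst coeff_mult_le) auto
  moreover have "Polynomial.degree (p a ^ l a * (\<Prod>i\<in>A. p i ^ l i)) \<le> l a * e + (\<Sum>i\<in>A. l i) * e"
    using degree_mult_le[of "p a ^ l a" "\<Prod>i\<in>A. p i ^ l i"] insert a by linarith
  ultimately show ?case using insert by (simp add: add_mult_distrib)
qed auto

text \<open>If the curve is homogenised in degree \<open>e\<close>, then \<open>F\<close> along it
  is homogenised in degree \<open>d * e\<close>, and the coefficient of that index is its value at
  infinity. It may vanish, so the argument runs with formal degrees instead of actual ones.\<close>

lemma subst_poly_homogeneous:
  assumes "\<And>i. Polynomial.degree (p i) \<le> e" "homogeneous_of d F"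
  shows "Polynomial.degree (subst_poly p F) \<le> d * e"
    and "Polynomial.coeff (subst_poly p F) (d * e) = peval F (\<lambda>i. Polynomial.coeff (p i) e)"
proof -
  have *: "Polynomial.degree (\<Prod>i\<in>Poly_Mapping.keys m. p i ^ Poly_Mapping.lookup m i) \<le> d * e \<and>
    Polynomial.coeff (\<Prod>i\<in>Poly_Mapping.keys m. p i ^ Poly_Mapping.lookup m i) (d * e)
      = mono_eval m (\<lambda>i. Polynomial.coeff (p i) e)" if "m \<in> Poly_Mapping.keys F" for m
    using degree_coeff_prod_le[of p e "Poly_Mapping.keys m" "Poly_Mapping.lookup m", OF assms(1)] assms(2) that
    by (auto simp: homogeneous_of_def mono_degree_def mono_eval_def)
  show "Polynomial.degree (subst_poly p F) \<le> d * e"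
    unfolding subst_poly_def
  proof (rule degree_sum_le)
    fix m assume "m \<in> Poly_Mapping.keys F"
    then show "Polynomial.degree (Polynomial.smult (Poly_Mapping.lookup F m)
        (\<Prod>i\<in>Poly_Mapping.keys m. p i ^ Poly_Mapping.lookup m i)) \<le> d * e"
      using * degree_smult_le order_trans by blast
  qed simp
  show "Polynomial.coeff (subst_poly p F) (d * e) = peval F (\<lambda>i. Polynomial.coeff (p i) e)"
    unfolding subst_poly_def peval_def using * by (simp add: coeff_sum)
qed

text \<open>The curve is \<open>s \<mapsto> (p\<^sub>0(s) : p\<^sub>1(s) : \<dots>)\<close>, homogenised in degree \<open>e\<close>. That the \<open>p\<^sub>j\<close> have no
  common zero, and not all degrees are below \<open>e\<close>, is implicit in the membership in \<open>V\<close>.\<close>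

locale rational_curve =
  fixes V :: "pt set" and p :: "nat \<Rightarrow> complex poly" and e :: nat
  assumes V_subset: "V \<subseteq> all_points"
    and degree_le: "\<And>j. Polynomial.degree (p j) \<le> e"
    and affine_in: "\<And>s. pclass (\<lambda>j. poly (p j) s) \<in> V"
    and infinity_in: "pclass (\<lambda>j. Polynomial.coeff (p j) e) \<in> V"
begin

definition cpt :: "complex \<Rightarrow> pt" where
  "cpt s = pclass (\<lambda>j. poly (p j) s)"

definition cinf :: pt where
  "cinf = pclass (\<lambda>j. Polynomial.coeff (p j) e)"

lemma cpt_in [simp]: "cpt s \<in> V" and cinf_in [simp]: "cinf \<in> V"
  using affine_in infinity_in by (auto simp: cpt_def cinf_def)

lemma subst_poly_nonzero:
  assumes K: "homogeneous_of d K" and x: "x \<in> insert cinf (range cpt)" "x \<in> nonvanishing K"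
  shows "subst_poly p K \<noteq> 0"
  using x(1)
proof (elim insertE rangeE)
  fix s assume "x = cpt s"
  then have "poly (subst_poly p K) s \<noteq> 0"
    using x(2) K unfolding poly_subst_poly by (simp add: cpt_def nonvanishing_pclass)
  then show ?thesis by auto
next
  assume "x = cinf"
  then have "Polynomial.coeff (subst_poly p K) (d * e) \<noteq> 0"
    using x(2) K subst_poly_homogeneous(2)[OF degree_le K] by (simp add: cinf_def nonvanishing_pclass)
  then show ?thesis by auto
qed

text \<open>An open set that meets the curve in one point, possibly the one at infinity, contains
  its general point: along the curve, \<open>K\<close> is a nonzero polynomial with finitely many
  roots.\<close>

lemma near_generic:
  assumes "x \<in> insert cinf (range cpt)" "near V x P"
  shows "\<forall>\<^sub>F s in cofinite. P (cpt s)"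
proof -
  obtain K d where K: "homogeneous_of d K" "x \<in> nonvanishing K" "\<forall>q\<in>V \<inter> nonvanishing K. P q"
    using assms(2) unfolding near_def by blast
  from eventually_cofinite_poly_nonzero[OF subst_poly_nonzero[OF K(1) assms(1) K(2)]]
  show ?thesis
  proof eventually_elim
    case (elim s)
    then have "cpt s \<in> nonvanishing K"
      unfolding poly_subst_poly using K(1) by (simp add: cpt_def nonvanishing_pclass)
    then show ?case using K(3) by simp
  qed
qed

lemma openin_generic:
  assumes "x \<in> insert cinf (range cpt)" "openin (subtopology zariski V) W" "x \<in> W"
  shows "\<forall>\<^sub>F s in cofinite. cpt s \<in> W"
  using near_generic[OF assms(1) near_openin[OF V_subset assms(2,3)]] .

text \<open>Near the given point the function is a quotient of forms \<open>F\<close> and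
  \<open>G\<close> of the same degree \<open>d\<close>; substituting the curve yields a fraction
  whose denominator does not vanish there. At infinity both polynomials have the common formal
  degree \<open>d * e\<close>.\<close>

lemma
  assumes f: "regular_on U f" and U: "openin (subtopology zariski V) U"
  shows regular_rat_at: "cpt a \<in> U \<Longrightarrow> rat_at a (\<lambda>s. f (cpt s)) (f (cpt a))"
    and regular_rat_at_infinity: "cinf \<in> U \<Longrightarrow> rat_at_infinity (\<lambda>s. f (cpt s)) (f cinf)"
proof -
  have UV: "U \<subseteq> V" using U openin_subset topspace_subtopology_zariski[OF V_subset] by blast
  have rep: "\<exists>F G d. homogeneous_of d F \<and> homogeneous_of d G \<and>
      ratrep (\<lambda>s. f (cpt s)) (subst_poly p F) (subst_poly p G) \<and>
      (\<forall>v\<in>x. peval G v \<noteq> 0 \<and> f x = peval F v / peval G v)"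
    if x: "x \<in> insert cinf (range cpt)" "x \<in> U" for x
  proof -
    obtain F G d where FG: "homogeneous_of d F" "homogeneous_of d G"
      "near U x (\<lambda>q. \<forall>v\<in>q. peval G v \<noteq> 0 \<and> f q = peval F v / peval G v)"
      using regular_on_near[OF f x(2)] UV V_subset by blast
    have n: "near V x (\<lambda>q. \<forall>v\<in>q. peval G v \<noteq> 0 \<and> f q = peval F v / peval G v)"
      by (rule near_subset[OF FG(3) near_openin[OF V_subset U x(2)]])
    have xV: "\<forall>v\<in>x. peval G v \<noteq> 0 \<and> f x = peval F v / peval G v"
      using FG(3) x(2) unfolding near_def by blast
    have "\<forall>\<^sub>F s in cofinite. f (cpt s) = poly (subst_poly p F) s / poly (subst_poly p G) s"
      using near_generic[OF x(1) n] unfolding poly_subst_poly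
      by eventually_elim (use pclass_self in \<open>auto simp: cpt_def\<close>)
    moreover have "x \<in> nonvanishing G" using xV by (simp add: nonvanishing_def)
    ultimately show ?thesis
      using FG(1,2) xV subst_poly_nonzero[OF FG(2) x(1)] unfolding ratrep_def by blast
  qed
  show "rat_at a (\<lambda>s. f (cpt s)) (f (cpt a))" if a: "cpt a \<in> U"
  proof -
    obtain F G where *: "ratrep (\<lambda>s. f (cpt s)) (subst_poly p F) (subst_poly p G)"
      "\<forall>v\<in>cpt a. peval G v \<noteq> 0 \<and> f (cpt a) = peval F v / peval G v"
      using rep[OF _ a] by blast
    then show ?thesis unfolding rat_at_def
      by (intro exI[of _ "subst_poly p F"] exI[of _ "subst_poly p G"]) (auto simp: poly_subst_poly cpt_def)
  qed
  show "rat_at_infinity (\<lambda>s. f (cpt s)) (f cinf)" if i: "cinf \<in> U"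
  proof -
    obtain F G d where *: "homogeneous_of d F" "homogeneous_of d G"
      "ratrep (\<lambda>s. f (cpt s)) (subst_poly p F) (subst_poly p G)"
      "\<forall>v\<in>cinf. peval G v \<noteq> 0 \<and> f cinf = peval F v / peval G v"
      using rep[OF _ i] by blast
    then show ?thesis unfolding rat_at_infinity_def
      using subst_poly_homogeneous[OF degree_le *(1)] subst_poly_homogeneous[OF degree_le *(2)]
      by (intro exI[of _ "subst_poly p F"] exI[of _ "subst_poly p G"] exI[of _ "d * e"])
        (auto simp: cinf_def)
  qed
qed

end

section \<open>The degree of a line bundle along a rational curve\<close>

lemma regular_on_subset:
  assumes "regular_on U f" "U' \<subseteq> U"
  shows "regular_on U' f"
  unfolding regular_on_def
proof
  fix p assume p: "p \<in> U'"
  obtain W F G d where *: "openin (subtopology zariski U) W" "p \<in> W"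
    "homogeneous_of d F" "homogeneous_of d G"
    "\<forall>q\<in>W. \<forall>v\<in>q. peval G v \<noteq> 0 \<and> f q = peval F v / peval G v"
    using bspec[OF assms(1)[unfolded regular_on_def], of p] p assms(2) by (blast elim!: exE conjE)
  have "openin (subtopology zariski U') (W \<inter> U')"
    using *(1) assms(2) unfolding openin_subtopology by blast
  moreover have "\<forall>q\<in>W \<inter> U'. \<forall>v\<in>q. peval G v \<noteq> 0 \<and> f q = peval F v / peval G v"
    using *(5) by blast
  ultimately show "\<exists>W F G d. openin (subtopology zariski U') W \<and> p \<in> W \<and> homogeneous_of d F \<and>
      homogeneous_of d G \<and> (\<forall>q\<in>W. \<forall>v\<in>q. peval G v \<noteq> 0 \<and> f q = peval F v / peval G v)"
    using *(2,3,4) p by (intro exI[of _ "W \<inter> U'"] exI[of _ F] exI[of _ G] exI[of _ d]) simp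
qed

lemma regular_on_mult:
  assumes "regular_on U f" "regular_on U g"
  shows "regular_on U (\<lambda>p. f p * g p)"
  unfolding regular_on_def
proof
  fix p assume p: "p \<in> U"
  obtain W F G d where *: "openin (subtopology zariski U) W" "p \<in> W"
    "homogeneous_of d F" "homogeneous_of d G"
    "\<forall>q\<in>W. \<forall>v\<in>q. peval G v \<noteq> 0 \<and> f q = peval F v / peval G v"
    using bspec[OF assms(1)[unfolded regular_on_def], of p] p by (blast elim!: exE conjE)
  obtain W' F' G' d' where **: "openin (subtopology zariski U) W'" "p \<in> W'"
    "homogeneous_of d' F'" "homogeneous_of d' G'"
    "\<forall>q\<in>W'. \<forall>v\<in>q. peval G' v \<noteq> 0 \<and> g q = peval F' v / peval G' v"
    using bspec[OF assms(2)[unfolded regular_on_def], of p] p by (blast elim!: exE conjE)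
  have "\<forall>q\<in>W \<inter> W'. \<forall>v\<in>q. peval (G * G') v \<noteq> 0 \<and> f q * g q = peval (F * F') v / peval (G * G') v"
    using *(5) **(5) by (auto simp: peval_mult)
  then show "\<exists>W F G d. openin (subtopology zariski U) W \<and> p \<in> W \<and> homogeneous_of d F \<and>
      homogeneous_of d G \<and> (\<forall>q\<in>W. \<forall>v\<in>q. peval G v \<noteq> 0 \<and> f q * g q = peval F v / peval G v)"
    using *(1-4) **(1-4) homogeneous_of_mult openin_Int
    by (intro exI[of _ "W \<inter> W'"] exI[of _ "F * F'"] exI[of _ "G * G'"] exI[of _ "d + d'"]) simp
qed

lemma regular_on_one:
  assumes "U \<subseteq> all_points"
  shows "regular_on U (\<lambda>p. 1)"
  unfolding regular_on_def
proof
  fix p assume p: "p \<in> U"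
  have "openin (subtopology zariski U) U"
    using openin_topspace[of "subtopology zariski U"] topspace_subtopology_zariski[OF assms] by simp
  then show "\<exists>W F G d. openin (subtopology zariski U) W \<and> p \<in> W \<and> homogeneous_of d F \<and>
      homogeneous_of d G \<and> (\<forall>q\<in>W. \<forall>v\<in>q. peval G v \<noteq> 0 \<and> 1 = peval F v / peval G v)"
    using p homogeneous_of_one
    by (intro exI[of _ U] exI[of _ 1] exI[of _ 0]) (simp add: peval_one)
qed

lemma line_bundle_tensor:
  assumes "line_bundle X (U, g)" "line_bundle X (U', g')"
  shows "line_bundle X (lb_tensor (U, g) (U', g'))"
proof -
  have 1: "\<And>x. x \<in> X \<Longrightarrow> openin (subtopology zariski X) (U x) \<and> x \<in> U x"
    "\<And>x y. x \<in> X \<Longrightarrow> y \<in> X \<Longrightarrow> regular_on (U x \<inter> U y) (g x y)"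
    "\<And>x p. x \<in> X \<Longrightarrow> p \<in> U x \<Longrightarrow> g x x p = 1"
    "\<And>x y z p. x \<in> X \<Longrightarrow> y \<in> X \<Longrightarrow> z \<in> X \<Longrightarrow> p \<in> U x \<inter> U y \<inter> U z \<Longrightarrow> g x y p * g y z p = g x z p"
    using assms(1) by (simp_all add: line_bundle_def)
  have 2: "\<And>x. x \<in> X \<Longrightarrow> openin (subtopology zariski X) (U' x) \<and> x \<in> U' x"
    "\<And>x y. x \<in> X \<Longrightarrow> y \<in> X \<Longrightarrow> regular_on (U' x \<inter> U' y) (g' x y)"
    "\<And>x p. x \<in> X \<Longrightarrow> p \<in> U' x \<Longrightarrow> g' x x p = 1"
    "\<And>x y z p. x \<in> X \<Longrightarrow> y \<in> X \<Longrightarrow> z \<in> X \<Longrightarrow> p \<in> U' x \<inter> U' y \<inter> U' z \<Longrightarrow> g' x y p * g' y z p = g' x z p"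
    using assms(2) by (simp_all add: line_bundle_def)
  have "regular_on (U x \<inter> U' x \<inter> (U y \<inter> U' y)) (\<lambda>p. g x y p * g' x y p)" if "x \<in> X" "y \<in> X" for x y
    by (intro regular_on_mult regular_on_subset[OF 1(2)[OF that]] regular_on_subset[OF 2(2)[OF that]]) auto
  moreover have "g x y p * g' x y p * (g y z p * g' y z p) = g x z p * g' x z p"
    if "x \<in> X" "y \<in> X" "z \<in> X" "p \<in> U x \<inter> U' x \<inter> (U y \<inter> U' y) \<inter> (U z \<inter> U' z)" for x y z p
  proof -
    have "g x z p = g x y p * g y z p" "g' x z p = g' x y p * g' y z p"
      using 1(4)[OF that(1,2,3), of p] 2(4)[OF that(1,2,3), of p] that(4) by auto
    then show ?thesis by simp
  qed
  ultimately show ?thesis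
    using 1(1,3) 2(1,3) by (simp add: line_bundle_def openin_Int)
qed

lemma line_bundle_trivial:
  assumes "X \<subseteq> all_points"
  shows "line_bundle X (lb_trivial X)"
  using openin_topspace[of "subtopology zariski X"] topspace_subtopology_zariski[OF assms] regular_on_one[OF assms]
  by (simp add: line_bundle_def lb_trivial_def)

lemma lb_iso_refl:
  assumes "line_bundle X (U, g)" "X \<subseteq> all_points"
  shows "((U, g), (U, g)) \<in> lb_iso X"
proof -
  have op: "\<And>x. x \<in> X \<Longrightarrow> openin (subtopology zariski X) (U x) \<and> x \<in> U x"
    using assms(1) by (simp add: line_bundle_def)
  have "U x \<subseteq> all_points" if "x \<in> X" for x
    using openin_subset[of "subtopology zariski X" "U x"] op[OF that] assms(2)
    by (auto simp: topspace_zariski)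
  then have "regular_on (U x) (\<lambda>p. 1)" if "x \<in> X" for x
    using regular_on_one that by blast
  then show ?thesis
    unfolding lb_iso_def using assms op
    by (auto intro!: exI[of _ U] exI[of _ "\<lambda>x p. 1"])
qed

context rational_curve
begin

text \<open>The degree is that of the divisor of the rational section which is \<open>1\<close> in the
  trivialisation at \<open>cinf\<close>; hence there is no contribution at infinity.\<close>

definition lb_degree :: "line_bundle_data \<Rightarrow> int" where
  "lb_degree L = Sum_any (\<lambda>a. rord a (\<lambda>s. snd L (cpt a) cinf (cpt s)))"

text \<open>These two facts make the sum in \<open>lb_degree\<close> meaningful: every summand is
  the order of a nonzero rational function, and only finitely many summands are nonzero.\<close>

lemma transition:
  assumes L: "line_bundle V (U, g)"
  shows "ratfun (\<lambda>s. g (cpt a) cinf (cpt s))"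
    and "finite {a. rord a (\<lambda>s. g (cpt a) cinf (cpt s)) \<noteq> 0}"
proof -
  have op: "\<And>x. x \<in> V \<Longrightarrow> openin (subtopology zariski V) (U x)" "\<And>x. x \<in> V \<Longrightarrow> x \<in> U x"
    and reg: "\<And>x y. x \<in> V \<Longrightarrow> y \<in> V \<Longrightarrow> regular_on (U x \<inter> U y) (g x y)"
    and id: "\<And>x p. x \<in> V \<Longrightarrow> p \<in> U x \<Longrightarrow> g x x p = 1"
    and coc: "\<And>x y z p. x \<in> V \<Longrightarrow> y \<in> V \<Longrightarrow> z \<in> V \<Longrightarrow> p \<in> U x \<inter> U y \<inter> U z \<Longrightarrow> g x y p * g y z p = g x z p"
    using L by (simp_all add: line_bundle_def)
  \<comment> \<open>Going to \<open>cinf\<close> and back, the cocycle condition exhibits an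
    inverse.\<close>
  have unit: "g (cpt a) cinf q \<noteq> 0" if "q \<in> U (cpt a)" "q \<in> U cinf" for a q
    using coc[of "cpt a" cinf "cpt a" q] id[of "cpt a" q] that by auto
  have at: "rat_at b (\<lambda>s. g (cpt a) cinf (cpt s)) (g (cpt a) cinf (cpt b))"
    if "cpt b \<in> U (cpt a)" "cpt b \<in> U cinf" for a b
    by (rule regular_rat_at[OF reg]) (use that op in \<open>auto intro: openin_Int\<close>)
  have gen: "\<forall>\<^sub>F s in cofinite. cpt s \<in> U cinf"
    by (rule openin_generic[of cinf]) (use op in auto)
  have "\<forall>\<^sub>F s in cofinite. cpt s \<in> U (cpt a)"
    by (rule openin_generic[of "cpt a"]) (use op in auto)
  with gen have "\<forall>\<^sub>F s in cofinite. cpt s \<in> U cinf \<and> cpt s \<in> U (cpt a)" by (rule eventually_conj)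
  then obtain b where b: "cpt b \<in> U cinf" "cpt b \<in> U (cpt a)" by (rule eventually_cofinite_ex) auto
  show "ratfun (\<lambda>s. g (cpt a) cinf (cpt s))"
    by (rule rat_at_unit(1)[OF at unit]) (use b in auto)
  \<comment> \<open>The section has zeros or poles only where the curve leaves the trivialising
    neighbourhood of \<open>cinf\<close>.\<close>
  have "{a. rord a (\<lambda>s. g (cpt a) cinf (cpt s)) \<noteq> 0} \<subseteq> {a. cpt a \<notin> U cinf}"
    using rat_at_unit(2)[OF at unit] op(2) by auto
  then show "finite {a. rord a (\<lambda>s. g (cpt a) cinf (cpt s)) \<noteq> 0}"
    using gen finite_subset by (auto simp: eventually_cofinite)
qed

text \<open>The local section at \<open>cpt a\<close> changes by \<open>h (cpt a)\<close>, a unit at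
  \<open>a\<close>, which leaves the order there unchanged. Normalising at \<open>cinf\<close>
  changes the section globally by \<open>h cinf\<close>; this is a unit at infinity, so its orders
  at finite points add up to 0.\<close>

lemma lb_degree_iso:
  assumes "(L, L') \<in> lb_iso V"
  shows "lb_degree L = lb_degree L'"
proof -
  obtain U g U' g' where LL: "L = (U, g)" "L' = (U', g')" by (cases L, cases L')
  then have L: "line_bundle V (U, g)" "line_bundle V (U', g')"
    using assms by (auto simp: lb_iso_def)
  obtain W h where Wh: "\<forall>x\<in>V. openin (subtopology zariski V) (W x) \<and> x \<in> W x \<and> W x \<subseteq> U x \<inter> U' x \<and>
                    regular_on (W x) (h x) \<and> (\<forall>p\<in>W x. h x p \<noteq> 0)"
      "\<forall>x\<in>V. \<forall>y\<in>V. \<forall>p\<in>W x \<inter> W y. h x p * g x y p = g' x y p * h y p"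
    using assms unfolding LL lb_iso_def by blast
  have inf: "rat_at_infinity (\<lambda>s. h cinf (cpt s)) (h cinf cinf)" "h cinf cinf \<noteq> 0"
    using Wh(1) by (auto intro!: regular_rat_at_infinity[of "W cinf"])
  note inf = rat_at_infinity_unit[OF inf]
  have eq: "rord a (\<lambda>s. g (cpt a) cinf (cpt s)) = rord a (\<lambda>s. g' (cpt a) cinf (cpt s)) + rord a (\<lambda>s. h cinf (cpt s))" for a
  proof -
    have "rat_at a (\<lambda>s. h (cpt a) (cpt s)) (h (cpt a) (cpt a))" "h (cpt a) (cpt a) \<noteq> 0"
      using Wh(1) by (auto intro!: regular_rat_at[of "W (cpt a)"])
    note u = rat_at_unit[OF this]
    have 1: "\<forall>\<^sub>F s in cofinite. cpt s \<in> W (cpt a)"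
      by (rule openin_generic[of "cpt a"]) (use Wh(1) in auto)
    have 2: "\<forall>\<^sub>F s in cofinite. cpt s \<in> W cinf"
      by (rule openin_generic[of cinf]) (use Wh(1) in auto)
    from 1 2 have "\<forall>\<^sub>F s in cofinite. h (cpt a) (cpt s) * g (cpt a) cinf (cpt s) = g' (cpt a) cinf (cpt s) * h cinf (cpt s)"
      by eventually_elim (use Wh(2) in auto)
    from rord_cong[OF this, of a] show ?thesis
      using rord_mult[OF u(1) transition(1)[OF L(1)], of a a] rord_mult[OF transition(1)[OF L(2)] inf(1), of a a] u(2)
      by simp
  qed
  show ?thesis
    unfolding LL lb_degree_def snd_conv eq
    using Sum_any.distrib[OF transition(2)[OF L(2)] inf(2)] inf(3) by simp
qed

lemma lb_degree_tensor:
  assumes "line_bundle V (U, g)" "line_bundle V (U', g')"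
  shows "lb_degree (lb_tensor (U, g) (U', g')) = lb_degree (U, g) + lb_degree (U', g')"
  unfolding lb_degree_def
  using rord_mult[OF transition(1)[OF assms(1)] transition(1)[OF assms(2)]]
    Sum_any.distrib[OF transition(2)[OF assms(1)] transition(2)[OF assms(2)]]
  by simp

lemma lb_degree_trivial: "lb_degree (lb_trivial V) = 0"
  by (simp add: lb_degree_def lb_trivial_def rord_1)

section \<open>Degrees of classes in the Picard group\<close>

definition class_degree_is :: "line_bundle_data set \<Rightarrow> int \<Rightarrow> bool" where
  "class_degree_is A k \<longleftrightarrow> A \<noteq> {} \<and> (\<forall>L\<in>A. line_bundle V L \<and> lb_degree L = k)"

lemma class_degree_is_unique: "class_degree_is A k \<Longrightarrow> class_degree_is A l \<Longrightarrow> k = l"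
  unfolding class_degree_is_def by auto

lemma class_degree_is_lb_iso:
  assumes "line_bundle V L"
  shows "class_degree_is (lb_iso V `` {L}) (lb_degree L)"
proof -
  obtain U g where L: "L = (U, g)" by (cases L)
  have "line_bundle V L' \<and> lb_degree L' = lb_degree L" if "(L, L') \<in> lb_iso V" for L'
    using lb_degree_iso[OF that] that by (auto simp: lb_iso_def)
  then show ?thesis
    using lb_iso_refl[of V U g] assms V_subset unfolding class_degree_is_def L by blast
qed

lemma class_degree_is_carrier:
  assumes "A \<in> carrier (Pic V)"
  shows "\<exists>k. class_degree_is A k"
  using assms class_degree_is_lb_iso by (auto simp: Pic_def quotient_def)

lemma class_degree_is_mult:
  assumes A: "class_degree_is A k" and B: "class_degree_is B l"
  shows "class_degree_is (A \<otimes>\<^bsub>Pic V\<^esub> B) (k + l)"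
proof -
  have T: "line_bundle V (lb_tensor L M) \<and> lb_degree (lb_tensor L M) = k + l" if "L \<in> A" "M \<in> B" for L M
    using line_bundle_tensor lb_degree_tensor A B that
    by (cases L; cases M) (force simp: class_degree_is_def)
  have eq: "A \<otimes>\<^bsub>Pic V\<^esub> B = lb_iso V `` {lb_tensor L M | L M. L \<in> A \<and> M \<in> B}"
    by (simp add: Pic_def)
  have "line_bundle V N' \<and> lb_degree N' = k + l" if "N' \<in> A \<otimes>\<^bsub>Pic V\<^esub> B" for N'
  proof -
    obtain L M where LM: "L \<in> A" "M \<in> B" "(lb_tensor L M, N') \<in> lb_iso V"
      using \<open>N' \<in> _\<close> unfolding eq by blast
    then show ?thesis using lb_degree_iso[OF LM(3)] T by (auto simp: lb_iso_def)
  qed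
  moreover obtain L M where LM: "L \<in> A" "M \<in> B" using A B unfolding class_degree_is_def by blast
  moreover have "(lb_tensor L M, lb_tensor L M) \<in> lb_iso V"
    using lb_iso_refl[of V "fst (lb_tensor L M)" "snd (lb_tensor L M)"] T[OF LM] V_subset by simp
  ultimately show ?thesis unfolding class_degree_is_def eq by blast
qed

lemma class_degree_is_one: "class_degree_is \<one>\<^bsub>Pic V\<^esub> 0"
  using class_degree_is_lb_iso[OF line_bundle_trivial[OF V_subset]] lb_degree_trivial
  by (simp add: Pic_def)

lemma class_degree_is_pow:
  assumes "class_degree_is A k"
  shows "class_degree_is (A [^]\<^bsub>Pic V\<^esub> (m::nat)) (int m * k)"
proof (induction m)
  case 0
  then show ?case using class_degree_is_one by (simp add: nat_pow_def)
next
  case (Suc m)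
  from class_degree_is_mult[OF this assms] show ?case
    by (simp add: nat_pow_def algebra_simps)
qed

text \<open>Made total by the value 0, since the free vector space underlying the tensor product is
  formed over all sets of bundle data and not only over the carrier.\<close>

definition class_degree :: "line_bundle_data set \<Rightarrow> real" where
  "class_degree A = (if \<exists>k. class_degree_is A k then of_int (THE k. class_degree_is A k) else 0)"

lemma class_degree_eq:
  assumes "class_degree_is A k"
  shows "class_degree A = of_int k"
proof -
  have "(THE k. class_degree_is A k) = k"
    using assms class_degree_is_unique by (intro the_equality) blast+
  then show ?thesis using assms by (auto simp: class_degree_def)
qed

lemma class_degree_mult:
  assumes "A \<in> carrier (Pic V)" "B \<in> carrier (Pic V)"
  shows "class_degree (A \<otimes>\<^bsub>Pic V\<^esub> B) = class_degree A + class_degree B"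
proof -
  obtain k l where kl: "class_degree_is A k" "class_degree_is B l"
    using assms class_degree_is_carrier by blast
  show ?thesis
    using class_degree_eq[OF class_degree_is_mult[OF kl]] kl[THEN class_degree_eq] by simp
qed

section \<open>The degree functional on the real Picard group\<close>

definition real_degree :: "(line_bundle_data set \<Rightarrow>\<^sub>0 real) \<Rightarrow> real" where
  "real_degree v = (\<Sum>A\<in>Poly_Mapping.keys v. Poly_Mapping.lookup v A * class_degree A)"

lemma real_degree_superset:
  assumes "finite S" "Poly_Mapping.keys v \<subseteq> S"
  shows "real_degree v = (\<Sum>A\<in>S. Poly_Mapping.lookup v A * class_degree A)"
  unfolding real_degree_def using assms
  by (intro sum.mono_neutral_left) (auto simp: in_keys_iff)

lemma real_degree_add: "real_degree (v + w) = real_degree v + real_degree w"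
proof -
  let ?S = "Poly_Mapping.keys v \<union> Poly_Mapping.keys w"
  have "real_degree (v + w) = (\<Sum>A\<in>?S. Poly_Mapping.lookup (v + w) A * class_degree A)"
    by (rule real_degree_superset) (use keys_add[of v w] in auto)
  then show ?thesis
    by (simp add: real_degree_superset[of ?S] lookup_add ring_distribs sum.distrib)
qed

lemma real_degree_scale: "real_degree (free_scale r v) = r * real_degree v"
proof -
  have "real_degree (free_scale r v) = (\<Sum>A\<in>Poly_Mapping.keys v. Poly_Mapping.lookup (free_scale r v) A * class_degree A)"
    by (rule real_degree_superset) (auto simp: in_keys_iff lookup_free_scale)
  then show ?thesis by (simp add: real_degree_def lookup_free_scale sum_distrib_left mult.assoc)
qed

lemma real_degree_single: "real_degree (Poly_Mapping.single A r) = r * class_degree A"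
  by (simp add: real_degree_def)

lemma real_degree_zero: "real_degree 0 = 0"
  by (simp add: real_degree_def)

lemma real_degree_diff: "real_degree (v - w) = real_degree v - real_degree w"
  using real_degree_add[of "v - w" w] by simp

text \<open>Additivity of the degree kills the generating relations, and linearity carries this to
  their span; hence the functional descends to cosets.\<close>

lemma real_degree_span:
  assumes "v \<in> module.span free_scale (additive_relations (Pic V))"
  shows "real_degree v = 0"
proof -
  interpret F: vector_space "free_scale :: real \<Rightarrow> (line_bundle_data set \<Rightarrow>\<^sub>0 real) \<Rightarrow> _"
    by (rule vector_space_free_scale)
  show ?thesis
    using assms
  proof (induction rule: F.span_induct)
    case base
    show ?case
      by (rule F.subspaceI) (auto simp: real_degree_add real_degree_scale real_degree_zero)
  next
    case (step x)
    then show ?case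
      by (auto simp: additive_relations_def real_degree_diff real_degree_single class_degree_mult)
  qed
qed

text \<open>The support condition makes \<open>v\<close> a member of its own coset, hence of the
  coset of \<open>w\<close>; so their difference is a combination of relations.\<close>

lemma real_tensor_class_degree:
  assumes "real_tensor_class (Pic V) v = real_tensor_class (Pic V) w"
    and "Poly_Mapping.keys v \<subseteq> carrier (Pic V)"
  shows "real_degree v = real_degree w"
proof -
  interpret F: vector_space "free_scale :: real \<Rightarrow> (line_bundle_data set \<Rightarrow>\<^sub>0 real) \<Rightarrow> _"
    by (rule vector_space_free_scale)
  have "v \<in> real_tensor_class (Pic V) v"
    using assms(2) F.span_zero by (simp add: real_tensor_class_def)
  then have "v - w \<in> F.span (additive_relations (Pic V))"
    unfolding assms(1) by (simp add: real_tensor_class_def)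
  from real_degree_span[OF this] show ?thesis by (simp add: real_degree_diff)
qed

end

section \<open>Pullbacks of the hyperplane bundle\<close>

lemma chart_nonzero:
  assumes "p \<in> all_points" "v \<in> p"
  shows "v (chart p) \<noteq> 0"
proof -
  obtain i where "v i \<noteq> 0" using all_points_D(3)[OF assms] by blast
  then have "\<exists>v\<in>p. v i \<noteq> 0" using assms by blast
  then have "\<exists>v\<in>p. v (chart p) \<noteq> 0" unfolding chart_def by (rule LeastI)
  then obtain w where w: "w \<in> p" "w (chart p) \<noteq> 0" by blast
  have "w \<in> pclass v" using w(1) all_points_D(2)[OF assms] by simp
  then show ?thesis using w(2) pclass_zero_iff by blast
qed

lemma lb_pullback_hyperplane:
  assumes "morphism X (PS n) f" "X \<subseteq> all_points"
  shows "lb_pullback X f (hyperplane_bundle n) =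
    ((\<lambda>x. {p \<in> X. \<forall>w\<in>f p. w (chart (f x)) \<noteq> 0}),
     (\<lambda>x y p. coord_ratio (chart (f x)) (chart (f y)) (f p)))"
proof -
  have "f p \<in> PS n" if "p \<in> X" for p
    using morphism_image[OF assms PS_subset_all_points that] .
  then have "{p \<in> X. f p \<in> PS n \<and> P p} = {p \<in> X. P p}" for P by blast
  then show ?thesis by (simp add: hyperplane_bundle_def coord_ratio_def)
qed

lemma line_bundle_pullback_hyperplane:
  assumes f: "morphism X (PS n) f" and X: "X \<subseteq> all_points"
  shows "line_bundle X (lb_pullback X f (hyperplane_bundle n))"
proof -
  have fp: "f p \<in> all_points" if "p \<in> X" for p
    using morphism_image[OF f X PS_subset_all_points that] PS_subset_all_points by blast
  let ?U = "\<lambda>x. {p \<in> X. \<forall>w\<in>f p. w (chart (f x)) \<noteq> 0}"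
  let ?g = "\<lambda>x y p. coord_ratio (chart (f x)) (chart (f y)) (f p)"
  have "openin (subtopology zariski X) (?U x) \<and> x \<in> ?U x" if "x \<in> X" for x
    using morphism_coord_openin[OF f X PS_subset_all_points] chart_nonzero[OF fp] that by auto
  moreover have "regular_on (?U x \<inter> ?U y) (?g x y)" for x y
    by (rule regular_on_subset[OF morphism_coord_regular[OF f X PS_subset_all_points]]) auto
  moreover have "?g x x p = 1" if "p \<in> ?U x" for x p
  proof -
    have p: "f p \<in> all_points" using fp that by blast
    obtain w where "w \<in> f p" using all_points_D(1)[OF p] by blast
    then show ?thesis using coord_ratio_eq[OF p] that by auto
  qed
  moreover have "?g x y p * ?g y z p = ?g x z p" if "p \<in> ?U x \<inter> ?U y \<inter> ?U z" for x y z p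
  proof -
    have p: "f p \<in> all_points" using fp that by blast
    obtain w where "w \<in> f p" using all_points_D(1)[OF p] by blast
    then show ?thesis using coord_ratio_eq[OF p] that by auto
  qed
  ultimately show ?thesis
    unfolding lb_pullback_hyperplane[OF f X] line_bundle_def by simp
qed

text \<open>A closed embedding is an isomorphism onto its image, whereas the degree of a pullback is
  computed for morphisms into the ambient projective space.\<close>

lemma morphism_enlarge:
  assumes f: "morphism X (f ` X) f" and X: "X \<subseteq> all_points" and Y: "f ` X \<subseteq> Y" "Y \<subseteq> all_points"
  shows "morphism X Y f"
  unfolding morphism_def
proof (intro conjI allI impI)
  have "continuous_map (subtopology zariski X) zariski f"
    using f unfolding morphism_def continuous_map_in_subtopology by blast
  then show "continuous_map (subtopology zariski X) (subtopology zariski Y) f"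
    using Y unfolding continuous_map_in_subtopology topspace_subtopology_zariski[OF X] by blast
next
  fix W h assume Wh: "openin (subtopology zariski Y) W \<and> regular_on W h"
  have "openin (subtopology zariski (f ` X)) (W \<inter> f ` X)"
    using Wh Y(1) unfolding openin_subtopology by blast
  moreover have "regular_on (W \<inter> f ` X) h" using Wh regular_on_subset by blast
  ultimately have "regular_on {p \<in> X. f p \<in> W \<inter> f ` X} (h \<circ> f)"
    using f unfolding morphism_def by blast
  moreover have "{p \<in> X. f p \<in> W \<inter> f ` X} = {p \<in> X. f p \<in> W}" by blast
  ultimately show "regular_on {p \<in> X. f p \<in> W} (h \<circ> f)" by simp
qed

lemma rord_generically_constant:
  assumes "\<forall>\<^sub>F s in cofinite. u s = c" "c \<noteq> 0"
  shows "rord a u = 0"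
proof -
  have "ratrep u [:c:] 1" using assms by (simp add: ratrep_def)
  then have "rat_at a u c" unfolding rat_at_def by (intro exI[of _ "[:c:]"] exI[of _ 1]) simp
  then show ?thesis using rat_at_unit(2) assms(2) by blast
qed

context rational_curve
begin

lemma generically_constant_of_coords:
  assumes f: "morphism V (PS n) f"
    and c: "\<forall>\<^sub>F s in cofinite. \<forall>w\<in>f (cpt s). w c \<noteq> 0"
    and k: "\<And>j. \<forall>\<^sub>F s in cofinite. coord_ratio c j (f (cpt s)) = k j"
  shows "\<forall>\<^sub>F s in cofinite. f (cpt s) = pclass (\<lambda>j. if j \<le> n then k j else 0)"
proof -
  have "\<forall>\<^sub>F s in cofinite. \<forall>j\<in>{..n}. coord_ratio c j (f (cpt s)) = k j"
    using k by (simp add: eventually_ball_finite)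
  with c show ?thesis
  proof eventually_elim
    case (elim s)
    have fs: "f (cpt s) \<in> PS n" using morphism_image[OF f V_subset PS_subset_all_points] by simp
    then have fa: "f (cpt s) \<in> all_points" using PS_subset_all_points by blast
    obtain w where w: "w \<in> f (cpt s)" using all_points_D(1)[OF fa] by blast
    have "w j = w c * (if j \<le> n then k j else 0)" for j
    proof (cases "j \<le> n")
      case True
      then have "w j / w c = k j" using elim(2) coord_ratio_eq[OF fa w] by simp
      then show ?thesis using True elim(1) w by (auto simp: field_simps)
    next
      case False
      then show ?thesis using PS_D(3)[OF fs w] by simp
    qed
    then have "w = (\<lambda>j. w c * (if j \<le> n then k j else 0))" by (rule ext)
    then have "w \<in> pclass (\<lambda>j. if j \<le> n then k j else 0)"
      unfolding mem_pclass_iff using elim(1) w by blast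
    then show ?case using all_points_D(2)[OF fa w] pclass_eqI by simp
  qed
qed

text \<open>Some value \<open>q\<close> is taken at infinitely many parameters. Near a point with
  that value the coordinate ratios are rational functions of \<open>s\<close>, and a rational
  function that takes one value infinitely often is constant.\<close>

lemma constant_of_finitely_many_values:
  assumes f: "morphism V (PS n) f" and "finite S" and S: "\<forall>\<^sub>F s in cofinite. f (cpt s) \<in> S"
  shows "\<exists>q. \<forall>\<^sub>F s in cofinite. f (cpt s) = q"
proof -
  have "infinite {s. f (cpt s) \<in> S}"
  proof
    assume "finite {s. f (cpt s) \<in> S}"
    moreover have "finite {s. f (cpt s) \<notin> S}" using S by (simp add: eventually_cofinite)
    ultimately have "finite ({s. f (cpt s) \<in> S} \<union> {s. f (cpt s) \<notin> S})" by blast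
    then have "finite (UNIV :: complex set)" by (rule finite_subset[rotated]) auto
    then show False by (simp add: infinite_UNIV_char_0)
  qed
  moreover have "{s. f (cpt s) \<in> S} = (\<Union>q\<in>S. {s. f (cpt s) = q})" by blast
  ultimately obtain q where q: "infinite {s. f (cpt s) = q}" using \<open>finite S\<close> by auto
  then obtain a where a: "f (cpt a) = q" using not_finite_existsD by blast
  have fp: "f (cpt s) \<in> all_points" for s
    using morphism_image[OF f V_subset PS_subset_all_points, of "cpt s"] PS_subset_all_points by auto
  obtain w where w: "w \<in> q" using all_points_D(1)[OF fp[of a]] a by blast
  define c where "c = chart q"
  let ?O = "{p \<in> V. \<forall>w\<in>f p. w c \<noteq> 0}"
  have op: "openin (subtopology zariski V) ?O"
    using morphism_coord_openin[OF f V_subset PS_subset_all_points] .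
  have aO: "cpt a \<in> ?O" using chart_nonzero[OF fp[of a]] a by (simp add: c_def)
  have gen: "\<forall>\<^sub>F s in cofinite. \<forall>w\<in>f (cpt s). w c \<noteq> 0"
    using openin_generic[OF _ op aO] by simp
  have "\<forall>\<^sub>F s in cofinite. coord_ratio c j (f (cpt s)) = w j / w c" for j
  proof -
    have "rat_at a (\<lambda>s. coord_ratio c j (f (cpt s))) (coord_ratio c j (f (cpt a)))"
      using regular_rat_at[OF morphism_coord_regular[OF f V_subset PS_subset_all_points] op aO] .
    then obtain P Q where PQ: "ratrep (\<lambda>s. coord_ratio c j (f (cpt s))) P Q"
      by (auto simp: rat_at_def)
    define k where "k = w j / w c"
    have "Q \<noteq> 0" and fin: "finite {s. coord_ratio c j (f (cpt s)) \<noteq> poly P s / poly Q s}"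
      using PQ by (auto simp: ratrep_def eventually_cofinite)
    have val: "coord_ratio c j (f (cpt s)) = k" if "f (cpt s) = q" for s
      using coord_ratio_eq[OF fp[of s]] that w by (simp add: k_def)
    \<comment> \<open>Every parameter with value \<open>q\<close> is a root of this polynomial,
      apart from finitely many exceptions.\<close>
    have "P - Polynomial.smult k Q = 0"
    proof (rule ccontr)
      assume "P - Polynomial.smult k Q \<noteq> 0"
      then have "finite {s. poly (P - Polynomial.smult k Q) s = 0}" by (rule poly_roots_finite)
      moreover have "finite {s. poly Q s = 0}" using \<open>Q \<noteq> 0\<close> by (rule poly_roots_finite)
      moreover have "{s. f (cpt s) = q} \<subseteq> {s. poly (P - Polynomial.smult k Q) s = 0} \<union> {s. poly Q s = 0}
          \<union> {s. coord_ratio c j (f (cpt s)) \<noteq> poly P s / poly Q s}"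
      proof
        fix s assume "s \<in> {s. f (cpt s) = q}"
        then have "coord_ratio c j (f (cpt s)) = k" using val by simp
        then show "s \<in> {s. poly (P - Polynomial.smult k Q) s = 0} \<union> {s. poly Q s = 0}
          \<union> {s. coord_ratio c j (f (cpt s)) \<noteq> poly P s / poly Q s}"
          by (auto simp: field_simps)
      qed
      ultimately show False using q fin finite_subset by blast
    qed
    then have P: "P = Polynomial.smult k Q" by simp
    have "\<forall>\<^sub>F s in cofinite. coord_ratio c j (f (cpt s)) = poly P s / poly Q s"
      using PQ by (simp add: ratrep_def)
    with eventually_cofinite_poly_nonzero[OF \<open>Q \<noteq> 0\<close>] show ?thesis
      by eventually_elim (simp add: P k_def)
  qed
  from generically_constant_of_coords[OF f gen this] show ?thesis by blast
qed

text \<open>The section that is 1 in the trivialisation at \<open>cinf\<close> is the pullback of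
  the coordinate of index \<open>c\<close>, and \<open>u a\<close> is its local equation at
  \<open>cpt a\<close>. Being regular, it has no poles, so the degree is nonnegative. Degree 0 means
  that this coordinate vanishes nowhere on the curve; then all ratios by it are regular on the whole
  projective line and hence constant.\<close>

lemma degree_pullback_hyperplane:
  assumes f: "morphism V (PS n) f"
  shows "class_degree (pullback_hyperplane_class V n f) \<ge> 0"
    and "class_degree (pullback_hyperplane_class V n f) = 0 \<longleftrightarrow> (\<exists>q. \<forall>\<^sub>F s in cofinite. f (cpt s) = q)"
proof -
  let ?L = "lb_pullback V f (hyperplane_bundle n)"
  let ?O = "\<lambda>c. {p \<in> V. \<forall>w\<in>f p. w c \<noteq> 0}"
  define c where "c = chart (f cinf)"
  define u where "u a s = coord_ratio (chart (f (cpt a))) c (f (cpt s))" for a s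
  have lb: "line_bundle V ?L" by (rule line_bundle_pullback_hyperplane[OF f V_subset])
  have cd: "class_degree (pullback_hyperplane_class V n f) = of_int (lb_degree ?L)"
    unfolding pullback_hyperplane_class_def by (rule class_degree_eq[OF class_degree_is_lb_iso[OF lb]])
  have deg: "lb_degree ?L = Sum_any (\<lambda>a. rord a (u a))"
    unfolding lb_degree_def lb_pullback_hyperplane[OF f V_subset] u_def c_def by simp
  have fp: "f p \<in> all_points" if "p \<in> V" for p
    using morphism_image[OF f V_subset PS_subset_all_points that] PS_subset_all_points by blast
  have ratfun: "ratfun (u a)" for a
    using transition(1)[OF lb[unfolded lb_pullback_hyperplane[OF f V_subset]], of a]
    by (simp add: u_def[abs_def] c_def)
  have fin: "finite {a. rord a (u a) \<noteq> 0}"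
    using transition(2)[OF lb[unfolded lb_pullback_hyperplane[OF f V_subset]]]
    by (simp add: u_def[abs_def] c_def)
  have op: "openin (subtopology zariski V) (?O i)" for i
    using morphism_coord_openin[OF f V_subset PS_subset_all_points] .
  have own: "p \<in> ?O (chart (f p))" if "p \<in> V" for p
    using chart_nonzero[OF fp[OF that]] that by simp
  have reg: "regular_on (?O i) (\<lambda>p. coord_ratio i j (f p))" for i j
    using morphism_coord_regular[OF f V_subset PS_subset_all_points] .
  have at: "rat_at a (u a) (u a a)" for a
    unfolding u_def by (rule regular_rat_at[OF reg op]) (use own in simp)
  have nonneg: "rord a (u a) \<ge> 0" for a
    using rat_at_rord_nonneg(1)[OF at ratfun] .
  have sum: "lb_degree ?L = (\<Sum>a | rord a (u a) \<noteq> 0. rord a (u a))"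
    unfolding deg by (simp add: Sum_any.expand_set)
  show "class_degree (pullback_hyperplane_class V n f) \<ge> 0"
    unfolding cd sum of_int_0_le_iff by (intro sum_nonneg nonneg)
  show "class_degree (pullback_hyperplane_class V n f) = 0 \<longleftrightarrow> (\<exists>q. \<forall>\<^sub>F s in cofinite. f (cpt s) = q)"
  proof
    assume "class_degree (pullback_hyperplane_class V n f) = 0"
    then have "(\<Sum>a | rord a (u a) \<noteq> 0. rord a (u a)) = 0" unfolding cd sum of_int_eq_0_iff .
    then have "rord a (u a) = 0" for a
      using sum_nonneg_eq_0_iff[OF fin, of "\<lambda>a. rord a (u a)"] nonneg by auto
    \<comment> \<open>A sum of nonnegative orders is 0 only if each is, so the section has no zeros
      either.\<close>
    then have ua: "u a a \<noteq> 0" for a using rat_at_rord_nonneg(2)[OF at ratfun] by blast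
    have inO: "cpt a \<in> ?O c" for a
    proof -
      have "w c \<noteq> 0" if "w \<in> f (cpt a)" for w
        using ua[of a] coord_ratio_eq[OF fp[OF cpt_in] that] by (auto simp: u_def)
      then show ?thesis by simp
    qed
    have "\<exists>k. \<forall>\<^sub>F s in cofinite. coord_ratio c j (f (cpt s)) = k" for j
    proof (rule rat_at_everywhere_constant)
      show "\<exists>d. rat_at a (\<lambda>s. coord_ratio c j (f (cpt s))) d" for a
        using regular_rat_at[OF reg op inO] by blast
      show "rat_at_infinity (\<lambda>s. coord_ratio c j (f (cpt s))) (coord_ratio c j (f cinf))"
        using regular_rat_at_infinity[OF reg op own[OF cinf_in, folded c_def]] .
    qed
    then obtain k where k: "\<And>j. \<forall>\<^sub>F s in cofinite. coord_ratio c j (f (cpt s)) = k j" by metis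
    have "\<forall>\<^sub>F s in cofinite. \<forall>w\<in>f (cpt s). w c \<noteq> 0" using inO by simp
    from generically_constant_of_coords[OF f this k] show "\<exists>q. \<forall>\<^sub>F s in cofinite. f (cpt s) = q" by blast
  next
    assume "\<exists>q. \<forall>\<^sub>F s in cofinite. f (cpt s) = q"
    then obtain q where q: "\<forall>\<^sub>F s in cofinite. f (cpt s) = q" by blast
    have "rord a (u a) = 0" for a
    proof -
      have 1: "\<forall>\<^sub>F s in cofinite. cpt s \<in> ?O c"
        by (rule openin_generic[OF _ op, of cinf]) (use own[OF cinf_in] in \<open>simp_all add: c_def\<close>)
      have 2: "\<forall>\<^sub>F s in cofinite. cpt s \<in> ?O (chart (f (cpt a)))"
        by (rule openin_generic[OF _ op, of "cpt a"]) (use own[OF cpt_in] in simp_all)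
      \<comment> \<open>A parameter in both charts is needed to see that the constant value of
        \<open>u a\<close> is not 0, which division by zero could otherwise produce.\<close>
      have "\<forall>\<^sub>F s in cofinite. f (cpt s) = q \<and> cpt s \<in> ?O c \<and> cpt s \<in> ?O (chart (f (cpt a)))"
        using q 1 2 by eventually_elim simp
      then obtain b where b: "f (cpt b) = q" "cpt b \<in> ?O c" "cpt b \<in> ?O (chart (f (cpt a)))"
        by (rule eventually_cofinite_ex) auto
      obtain w where w: "w \<in> q" using all_points_D(1)[OF fp[OF cpt_in, of b]] b(1) by blast
      have nz: "u a b \<noteq> 0"
        using coord_ratio_eq[OF fp[OF cpt_in, of b]] b w by (auto simp: u_def)
      have "\<forall>\<^sub>F s in cofinite. u a s = u a b"
        using q by eventually_elim (simp add: u_def b(1))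
      then show ?thesis using nz by (rule rord_generically_constant)
    qed
    then show "class_degree (pullback_hyperplane_class V n f) = 0" unfolding cd deg by simp
  qed
qed

text \<open>A multiple of \<open>A\<close> is the pullback of O(1) by a closed embedding. Its left
  inverse would turn a generically constant image back into a generically constant curve, so the
  multiple has positive degree, and dividing by \<open>m\<close> gives the claim.\<close>

lemma ample_class_degree_pos:
  assumes nonconst: "\<And>q. \<not> (\<forall>\<^sub>F s in cofinite. cpt s = q)" and A: "ample_class V A"
  shows "class_degree A > 0"
proof -
  obtain k where k: "class_degree_is A k"
    using A class_degree_is_carrier unfolding ample_class_def by blast
  obtain m :: nat where m: "m > 0" "very_ample_class V (A [^]\<^bsub>Pic V\<^esub> m)"
    using A unfolding ample_class_def by blast
  then obtain n f where emb: "closed_embedding V (PS n) f"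
    and eq: "A [^]\<^bsub>Pic V\<^esub> m = pullback_hyperplane_class V n f"
    unfolding very_ample_class_def by blast
  have emb: "f ` V \<subseteq> PS n" "morphism V (f ` V) f" "\<exists>g. \<forall>p\<in>V. g (f p) = p"
    using emb unfolding closed_embedding_def isomorphism_def by (blast, blast, metis)
  have f: "morphism V (PS n) f"
    by (rule morphism_enlarge[OF emb(2) V_subset emb(1) PS_subset_all_points])
  obtain g where g: "\<forall>p\<in>V. g (f p) = p" using emb(3) ..
  have "\<not> (\<forall>\<^sub>F s in cofinite. f (cpt s) = q)" for q
  proof
    assume "\<forall>\<^sub>F s in cofinite. f (cpt s) = q"
    then have "\<forall>\<^sub>F s in cofinite. cpt s = g q"
      by eventually_elim (use g cpt_in in metis)
    then show False using nonconst by blast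
  qed
  then have "class_degree (A [^]\<^bsub>Pic V\<^esub> m) > 0"
    unfolding eq using degree_pullback_hyperplane[OF f] by (auto simp: less_le)
  then have "real m * real_of_int k > 0"
    using class_degree_eq[OF class_degree_is_pow[OF k]] by simp
  then show ?thesis
    using class_degree_eq[OF k] m(1) by (simp add: zero_less_mult_iff)
qed

end

section \<open>Lifting the line at infinity\<close>

text \<open>The outer variable is u and the inner one is s. With this nesting, division by a power
  of u is a shift of coefficients, and restriction to u = 0 is the constant coefficient, a
  polynomial in s.\<close>

definition eval2 :: "complex poly poly \<Rightarrow> complex \<Rightarrow> complex \<Rightarrow> complex" where
  "eval2 Q u s = poly (poly Q [:u:]) s"

definition hvec :: "complex \<Rightarrow> complex \<Rightarrow> complex \<Rightarrow> vec" where
  "hvec x y z = (\<lambda>i. if i = 0 then x else if i = 1 then y else if i = 2 then z else 0)"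

lemma hvec_in_PS: "x \<noteq> 0 \<or> y \<noteq> 0 \<or> z \<noteq> 0 \<Longrightarrow> pclass (hvec x y z) \<in> PS 2"
proof (rule PS_I)
  assume "x \<noteq> 0 \<or> y \<noteq> 0 \<or> z \<noteq> 0"
  then have "hvec x y z 0 \<noteq> 0 \<or> hvec x y z 1 \<noteq> 0 \<or> hvec x y z 2 \<noteq> 0" by (simp add: hvec_def)
  then show "\<exists>i. hvec x y z i \<noteq> 0" by blast
qed (simp add: hvec_def)

text \<open>The coordinates of the generic point (u : s : 1). In this chart the line at infinity is
  u = 0, and of that line only (0 : 1 : 0) is missing.\<close>

definition hvec_poly :: "nat \<Rightarrow> complex poly poly" where
  "hvec_poly i = (if i = 0 then [:0, 1:] else if i = 1 then [:[:0, 1:]:] else if i = 2 then 1 else 0)"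

definition subst_poly2 :: "mpoly \<Rightarrow> complex poly poly" where
  "subst_poly2 F = (\<Sum>m\<in>Poly_Mapping.keys F. [:[:Poly_Mapping.lookup F m:]:] *
     (\<Prod>i\<in>Poly_Mapping.keys m. hvec_poly i ^ Poly_Mapping.lookup m i))"

lemma eval2_mult: "eval2 (P * Q) u s = eval2 P u s * eval2 Q u s"
  by (simp add: eval2_def)

lemma eval2_prod: "eval2 (prod f A) u s = (\<Prod>i\<in>A. eval2 (f i) u s)"
  by (simp add: eval2_def poly_prod)

lemma eval2_power: "eval2 (P ^ n) u s = eval2 P u s ^ n"
  by (simp add: eval2_def)

lemma eval2_hvec_poly: "eval2 (hvec_poly i) u s = hvec u s 1 i"
  by (simp add: eval2_def hvec_poly_def hvec_def)

lemma eval2_subst_poly2: "eval2 (subst_poly2 F) u s = peval F (hvec u s 1)"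
proof -
  have "eval2 (subst_poly2 F) u s = (\<Sum>m\<in>Poly_Mapping.keys F. eval2 ([:[:Poly_Mapping.lookup F m:]:] *
     (\<Prod>i\<in>Poly_Mapping.keys m. hvec_poly i ^ Poly_Mapping.lookup m i)) u s)"
    by (simp add: eval2_def subst_poly2_def poly_sum)
  also have "\<dots> = peval F (hvec u s 1)"
    unfolding peval_def mono_eval_def eval2_mult eval2_prod eval2_power eval2_hvec_poly
    by (simp add: eval2_def)
  finally show ?thesis .
qed

lemma eval2_eq_poly: "eval2 Q u s = poly (map_poly (\<lambda>c. poly c s) Q) u"
  by (induction Q) (simp_all add: eval2_def map_poly_pCons)

lemma tendsto_eval2: "((\<lambda>u. eval2 Q u s) \<longlongrightarrow> eval2 Q 0 s) (at 0)"
  unfolding eval2_eq_poly by (rule isContD) (rule poly_isCont)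

lemma eventually_not_in_finite:
  fixes a :: complex
  assumes "finite S"
  shows "\<forall>\<^sub>F u in at a. u \<notin> S"
proof -
  have "\<forall>\<^sub>F u in at a. \<forall>x\<in>S. u \<noteq> x"
    using assms by (simp add: eventually_ball_finite eventually_neq_at_within)
  then show ?thesis by eventually_elim blast
qed

text \<open>For s outside the roots of the leading coefficient in u, the restriction to the arc over
  s is a nonzero polynomial in u, so its roots stay away from a punctured neighbourhood of
  0.\<close>

lemma eval2_generically_nonzero:
  assumes "Q \<noteq> 0"
  shows "\<forall>\<^sub>F s in cofinite. \<forall>\<^sub>F u in at 0. eval2 Q u s \<noteq> 0"
proof -
  have "Polynomial.lead_coeff Q \<noteq> 0" using assms by simp
  from eventually_cofinite_poly_nonzero[OF this] show ?thesis
  proof eventually_elim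
    case (elim s)
    then have "Polynomial.coeff (map_poly (\<lambda>c. poly c s) Q) (Polynomial.degree Q) \<noteq> 0"
      by (simp add: coeff_map_poly)
    then have "map_poly (\<lambda>c. poly c s) Q \<noteq> 0" by auto
    from eventually_not_in_finite[OF poly_roots_finite[OF this], of 0]
    show ?case by (simp add: eval2_eq_poly)
  qed
qed

lemma tendsto_peval:
  assumes "\<And>i. ((\<lambda>u. X u i) \<longlongrightarrow> x i) F"
  shows "((\<lambda>u. peval G (X u)) \<longlongrightarrow> peval G x) F"
  unfolding peval_def mono_eval_def by (intro tendsto_intros assms)

text \<open>The given point may lie outside the chart with last coordinate 1. A small change
  \<open>t\<close> of its last coordinate moves it into the chart, and by continuity
  \<open>K\<close> stays nonzero.\<close>

lemma nonvanishing_at_hvec: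
  assumes K: "homogeneous_of d K" and q: "q \<in> PS 2" "q \<in> nonvanishing K"
  shows "subst_poly2 K \<noteq> 0"
proof -
  obtain v where v: "v \<in> q" using all_points_D(1) q PS_subset_all_points by blast
  have "peval K v \<noteq> 0" using v q by (simp add: nonvanishing_def)
  have v_eq: "v = hvec (v 0) (v 1) (v 2)"
    using PS_D(3)[OF q(1) v] by (auto simp: hvec_def fun_eq_iff)
  have "((\<lambda>t. peval K (hvec (v 0) (v 1) (v 2 + t))) \<longlongrightarrow> peval K v) (at 0)"
    by (subst v_eq, rule tendsto_peval) (auto simp: hvec_def intro!: tendsto_eq_intros)
  then have "\<forall>\<^sub>F t in at 0. peval K (hvec (v 0) (v 1) (v 2 + t)) \<noteq> 0"
    using \<open>peval K v \<noteq> 0\<close> by (rule tendsto_imp_eventually_ne)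
  moreover have "\<forall>\<^sub>F t in at 0. t \<noteq> - v 2"
    using eventually_not_in_finite[of "{- v 2}" 0] by simp
  ultimately have "\<forall>\<^sub>F t in at 0. peval K (hvec (v 0) (v 1) (v 2 + t)) \<noteq> 0 \<and> t \<noteq> - v 2"
    by (rule eventually_conj)
  then obtain t where t: "peval K (hvec (v 0) (v 1) (v 2 + t)) \<noteq> 0" "t \<noteq> - v 2"
    using eventually_happens'[of "at (0::complex)"] by (auto simp: at_neq_bot)
  define z where "z = v 2 + t"
  have z: "z \<noteq> 0" using t(2) by (auto simp: z_def add_eq_0_iff)
  have "hvec (v 0) (v 1) z = (\<lambda>i. z * hvec (v 0 / z) (v 1 / z) 1 i)"
    using z by (auto simp: hvec_def fun_eq_iff)
  then have "eval2 (subst_poly2 K) (v 0 / z) (v 1 / z) \<noteq> 0"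
    using t(1) peval_scale[OF K, of z] unfolding eval2_subst_poly2 z_def[symmetric] by auto
  then show ?thesis by (auto simp: eval2_def)
qed

text \<open>On a basic open set the inverse of \<pi> is given by quotients of forms. Restricting
  these to (u : s : 1) and clearing denominators gives polynomial coordinates \<open>A\<close>,
  while \<open>H\<close> is the equation \<open>K\<close> of the complement of that set.\<close>

lemma birational_inverse_parametrization:
  assumes bir: "birational_morphism V (PS 2) \<pi>" and V: "V \<subseteq> PS N"
  obtains A :: "nat \<Rightarrow> complex poly poly" and H where "H \<noteq> 0" "\<And>j. j > N \<Longrightarrow> A j = 0"
    "\<And>u s. eval2 H u s \<noteq> 0 \<Longrightarrow> pclass (\<lambda>j. eval2 (A j) u s) \<in> V \<and>
        \<pi> (pclass (\<lambda>j. eval2 (A j) u s)) = pclass (hvec u s 1)"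
proof -
  obtain U W where UW: "openin (subtopology zariski V) U" 
      "openin (subtopology zariski (PS 2)) W" "W \<noteq> {}" "isomorphism U W \<pi>"
    using bir unfolding birational_morphism_def by blast
  obtain g where g: "morphism W U g" "\<forall>q\<in>W. \<pi> (g q) = q"
    using UW(4) unfolding isomorphism_def by blast
  have UV: "U \<subseteq> V" using UW(1) unfolding openin_subtopology by blast
  have U: "U \<subseteq> all_points" "U \<subseteq> PS N" using UV V PS_subset_all_points by blast+
  have W: "W \<subseteq> PS 2" using UW(2) unfolding openin_subtopology by blast
  have Wa: "W \<subseteq> all_points" using W PS_subset_all_points by blast
  obtain w0 where w0: "w0 \<in> W" using UW(3) by blast
  have gq: "g q \<in> U" if "q \<in> W" for q using morphism_image[OF g(1) Wa U(1) that] .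
  obtain v0 where v0: "v0 \<in> g w0" using all_points_D(1) gq[OF w0] U(1) by blast
  obtain i where i: "v0 i \<noteq> 0" using all_points_D(3)[OF _ v0] gq[OF w0] U(1) by blast
  obtain F G \<delta> where n: "near W w0 (\<lambda>q. (\<forall>w\<in>g q. w i \<noteq> 0) \<and>
      (\<forall>j\<le>N. \<forall>v\<in>q. peval (G j) v \<noteq> 0 \<and> (\<forall>w\<in>g q. w j / w i = peval (F j) v / peval (G j) v)))"
    using morphism_near[OF g(1) Wa U(1) w0 v0 i, of N] by (elim exE conjE)
  have nW: "near (PS 2) w0 (\<lambda>q. q \<in> W)" by (rule near_openin[OF PS_subset_all_points UW(2) w0])
  from near_conj[OF nW near_subset[OF n nW]] obtain K d where K: "homogeneous_of d K" "w0 \<in> nonvanishing K"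
    and KW: "\<And>q. q \<in> PS 2 \<Longrightarrow> q \<in> nonvanishing K \<Longrightarrow> q \<in> W"
    and Kw: "\<And>q w. q \<in> PS 2 \<Longrightarrow> q \<in> nonvanishing K \<Longrightarrow> w \<in> g q \<Longrightarrow> w i \<noteq> 0"
    and KG: "\<And>q v j. q \<in> PS 2 \<Longrightarrow> q \<in> nonvanishing K \<Longrightarrow> v \<in> q \<Longrightarrow> j \<le> N \<Longrightarrow> peval (G j) v \<noteq> 0"
    and KF: "\<And>q v w j. q \<in> PS 2 \<Longrightarrow> q \<in> nonvanishing K \<Longrightarrow> v \<in> q \<Longrightarrow> w \<in> g q \<Longrightarrow> j \<le> N
      \<Longrightarrow> w j / w i = peval (F j) v / peval (G j) v"
    unfolding near_def by (elim exE conjE) simp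
  define A where "A j = (if j \<le> N then subst_poly2 (F j) * (\<Prod>k\<in>{..N} - {j}. subst_poly2 (G k)) else 0)" for j
  show ?thesis
  proof (rule that[of "subst_poly2 K" A])
    show "subst_poly2 K \<noteq> 0" using nonvanishing_at_hvec[OF K(1) _ K(2)] w0 W by blast
    show "A j = 0" if "j > N" for j using that by (simp add: A_def)
    fix u s assume "eval2 (subst_poly2 K) u s \<noteq> 0"
    define v where "v = hvec u s 1"
    define q where "q = pclass v"
    have q: "q \<in> PS 2" "q \<in> nonvanishing K" "v \<in> q"
      using \<open>eval2 _ u s \<noteq> 0\<close> hvec_in_PS nonvanishing_pclass[OF K(1)]
      by (simp_all add: eval2_subst_poly2 q_def v_def)
    obtain w where w: "w \<in> g q" using all_points_D(1) gq[OF KW[OF q(1,2)]] U(1) by blast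
    define D where "D = (\<Prod>k\<in>{..N}. peval (G k) v)"
    have D: "D \<noteq> 0" using KG[OF q] by (simp add: D_def)
    \<comment> \<open>The product \<open>D\<close> of all denominators is the common multiplier; one
      scalar serves for all coordinates, so the projective point is the right one.\<close>
    have "eval2 (A j) u s = D / w i * w j" for j
    proof (cases "j \<le> N")
      case True
      have "D = peval (G j) v * (\<Prod>k\<in>{..N} - {j}. peval (G k) v)"
        unfolding D_def using True by (intro prod.remove) auto
      moreover have "eval2 (A j) u s = peval (F j) v * (\<Prod>k\<in>{..N} - {j}. peval (G k) v)"
        using True by (simp add: A_def eval2_mult eval2_prod eval2_subst_poly2 v_def)
      moreover have "w j = w i * (peval (F j) v / peval (G j) v)"
        using KF[OF q w True] Kw[OF q(1,2) w] by (simp add: field_simps)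
      ultimately show ?thesis using KG[OF q True] Kw[OF q(1,2) w] by simp
    next
      case False
      have "g q \<in> PS N" using gq[OF KW[OF q(1,2)]] U(2) by blast
      then have "w j = 0" using False PS_D(3)[OF _ w] by simp
      then show ?thesis using False by (simp add: A_def eval2_def)
    qed
    then have "(\<lambda>j. eval2 (A j) u s) = (\<lambda>j. D / w i * w j)" by (rule ext)
    then have "pclass (\<lambda>j. eval2 (A j) u s) = pclass w"
      using pclass_scale[of "D / w i" w] D Kw[OF q(1,2) w] by simp
    also have "\<dots> = g q" using all_points_D(2)[OF _ w] gq[OF KW[OF q(1,2)]] U(1) by blast
    finally show "pclass (\<lambda>j. eval2 (A j) u s) \<in> V \<and>
        \<pi> (pclass (\<lambda>j. eval2 (A j) u s)) = pclass (hvec u s 1)"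
      using gq[OF KW[OF q(1,2)]] UV g(2) KW[OF q(1,2)] by (auto simp: q_def v_def)
  qed
qed

text \<open>Common roots are split off one at a time. The family may be infinite, so termination is
  measured by the degree of its one member known to be nonzero.\<close>

lemma remove_common_zeros:
  fixes q :: "'i \<Rightarrow> complex poly"
  assumes "q j \<noteq> 0"
  shows "\<exists>c p. c \<noteq> 0 \<and> (\<forall>j. q j = c * p j) \<and> (\<forall>a. \<exists>j. poly (p j) a \<noteq> 0)"
  using assms
proof (induction "Polynomial.degree (q j)" arbitrary: q rule: less_induct)
  case less
  show ?case
  proof (cases "\<forall>a. \<exists>j. poly (q j) a \<noteq> 0")
    case True
    then show ?thesis by (intro exI[of _ 1] exI[of _ q]) simp
  next
    case False
    then obtain a where "\<forall>j. poly (q j) a = 0" by blast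
    then have "\<forall>j. \<exists>r. q j = [:-a, 1:] * r" by (simp add: poly_eq_0_iff_dvd dvd_def)
    then obtain r where r: "\<forall>j. q j = [:-a, 1:] * r j" unfolding choice_iff by blast
    have rj: "r j \<noteq> 0" using r less(2) by auto
    have "Polynomial.degree (q j) = Suc (Polynomial.degree (r j))"
      using r rj degree_mult_eq[of "[:-a, 1:]" "r j"] by (simp del: mult_pCons_left)
    then obtain c p where cp: "c \<noteq> 0" "\<forall>j. r j = c * p j" "\<forall>a. \<exists>j. poly (p j) a \<noteq> 0"
      using less(1)[of r] rj by auto
    have "[:-a, 1:] * c \<noteq> 0" using cp(1) by (simp del: mult_pCons_left)
    moreover have "q j = [:-a, 1:] * c * p j" for j using r cp(2) by (simp add: mult.assoc del: mult_pCons_left)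
    ultimately show ?thesis using cp(3) by (intro exI[of _ "[:-a, 1:] * c"] exI[of _ p]) simp
  qed
qed

text \<open>The vector \<open>B u s\<close> is the inverse of \<open>\<pi>\<close> at \<open>(u : s : 1)\<close>, divided by the largest possible
  power of \<open>u\<close>. The common factor \<open>c\<close> of its values on the line at infinity \<open>u = 0\<close> is removed
  to get the curve, and \<open>H\<close> cuts out the locus where \<open>\<pi>\<close> need not be invertible.\<close>

locale lifted_line = rational_curve +
  fixes \<pi> :: "pt \<Rightarrow> pt" and B :: "nat \<Rightarrow> complex poly poly" and c :: "complex poly"
    and H :: "complex poly poly"
  assumes c_nonzero: "c \<noteq> 0" and H_nonzero: "H \<noteq> 0"
    and B_at_0: "\<And>j s. eval2 (B j) 0 s = poly c s * poly (p j) s"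
    and B_in: "\<And>u s. u \<noteq> 0 \<Longrightarrow> eval2 H u s \<noteq> 0 \<Longrightarrow> pclass (\<lambda>j. eval2 (B j) u s) \<in> V"
    and \<pi>_B: "\<And>u s. u \<noteq> 0 \<Longrightarrow> eval2 H u s \<noteq> 0 \<Longrightarrow>
      \<pi> (pclass (\<lambda>j. eval2 (B j) u s)) = pclass (hvec u s 1)"

section \<open>Extending the inverse of \<pi> over the line at infinity\<close>

lemma closedin_zariski_zero_locus:
  assumes "closedin zariski V"
  obtains S where "\<And>F. F \<in> S \<Longrightarrow> \<exists>d. homogeneous_of d F" "V = zero_locus S"
proof -
  have V: "V \<subseteq> all_points" using closedin_subset[OF assms] by (simp add: topspace_zariski)
  have "openin zariski (all_points - V)" using assms by (simp add: closedin_def topspace_zariski)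
  then obtain S where S: "\<forall>F\<in>S. \<exists>d. homogeneous_of d F" "all_points - V = all_points - zero_locus S"
    unfolding openin_zariski_iff by blast
  have "zero_locus S \<subseteq> all_points" by (auto simp: zero_locus_eq)
  then have "V = zero_locus S" using S(2) V by blast
  with S(1) show ?thesis using that by blast
qed

lemma pclass_in_zero_locus:
  assumes "\<And>F. F \<in> S \<Longrightarrow> \<exists>d. homogeneous_of d F" "\<And>F. F \<in> S \<Longrightarrow> peval F v = 0"
    and "pclass v \<in> all_points"
  shows "pclass v \<in> zero_locus S"
proof -
  have "peval F w = 0" if "F \<in> S" "w \<in> pclass v" for F w
    using assms(1)[OF that(1)] assms(2)[OF that(1)] peval_vanish_pclass[OF _ that(2) pclass_self] by blast
  then show ?thesis using assms(3) by (simp add: zero_locus_eq)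
qed

text \<open>The inverse of \<pi> may be undefined at every point of u = 0 as first written, when all
  its coordinates are divisible by u. Dividing by the full power of u leaves a vector that is not
  identically zero there, and the limit points belong to V because V is closed.\<close>

lemma lifted_line_exists:
  assumes bir: "birational_morphism V (PS 2) \<pi>" and VN: "V \<subseteq> PS N" and closed: "closedin zariski V"
  shows "\<exists>p e B c H. lifted_line V p e \<pi> B c H"
proof -
  obtain A H where H: "H \<noteq> 0" and A0: "\<And>j. j > N \<Longrightarrow> A j = 0"
    and A: "\<And>u s. eval2 H u s \<noteq> 0 \<Longrightarrow> pclass (\<lambda>j. eval2 (A j) u s) \<in> V \<and>
        \<pi> (pclass (\<lambda>j. eval2 (A j) u s)) = pclass (hvec u s 1)"
    using birational_inverse_parametrization[OF bir VN] by metis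
  have Va: "V \<subseteq> all_points" using VN PS_subset_all_points by blast
  \<comment> \<open>Otherwise a general point would be sent to the class of the zero vector, which
    is not a point of projective space.\<close>
  have "\<exists>l j. Polynomial.coeff (A j) l \<noteq> 0"
  proof (rule ccontr)
    assume "\<not> ?thesis"
    then have "A j = 0" for j by (auto intro: poly_eqI)
    obtain s where "\<forall>\<^sub>F u in at 0. eval2 H u s \<noteq> 0"
      using eval2_generically_nonzero[OF H] by (rule eventually_cofinite_ex)
    then obtain u where "eval2 H u s \<noteq> 0"
      using eventually_happens'[of "at (0::complex)"] by (auto simp: at_neq_bot)
    then have "pclass (\<lambda>j. eval2 (A j) u s) \<in> all_points" using A Va by blast
    from all_points_D(3)[OF this pclass_self] show False
      using \<open>\<And>j. A j = 0\<close> by (simp add: eval2_def)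
  qed
  define k where "k = (LEAST l. \<exists>j. Polynomial.coeff (A j) l \<noteq> 0)"
  obtain j0 where j0: "Polynomial.coeff (A j0) k \<noteq> 0"
    using LeastI_ex[OF \<open>\<exists>l j. _ l j\<close>] unfolding k_def by blast
  have less_k: "Polynomial.coeff (A j) l = 0" if "l < k" for j l
    using not_less_Least that unfolding k_def by blast
  define B where "B j = poly_shift k (A j)" for j
  have AB: "A j = monom 1 k * B j" for j
    by (rule poly_eqI) (auto simp: B_def coeff_monom_mult coeff_poly_shift less_k)
  have evAB: "eval2 (A j) u s = u ^ k * eval2 (B j) u s" for j u s
    unfolding AB eval2_mult by (simp add: eval2_def poly_monom)
  obtain c p where c: "c \<noteq> 0" and cp: "\<And>j. Polynomial.coeff (A j) k = c * p j"
    and nz: "\<And>a. \<exists>j. poly (p j) a \<noteq> 0"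
    using remove_common_zeros[of "\<lambda>j. Polynomial.coeff (A j) k" j0] j0 by blast
  have B0: "eval2 (B j) 0 s = poly c s * poly (p j) s" for j s
    using cp[of j] by (simp add: eval2_def B_def coeff_poly_shift poly_0_coeff_0)
  have p0: "p j = 0" if "j > N" for j
    using cp[of j] A0[OF that] c by simp
  define J where "J = {j. p j \<noteq> 0}"
  have J: "finite J" "J \<noteq> {}"
    using p0 nz[of 0] finite_subset[of J "{..N}"] by (force simp: J_def not_less[symmetric])+
  define e where "e = Max (Polynomial.degree ` p ` J)"
  have deg: "Polynomial.degree (p j) \<le> e" for j
    using J by (cases "p j = 0") (auto simp: e_def J_def intro!: Max_ge)
  have "e \<in> Polynomial.degree ` p ` J" unfolding e_def using J by (intro Max_in) auto
  \<comment> \<open>The bound \<open>e\<close> is attained, so the coefficients of index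
    \<open>e\<close> are not all zero and define the point at infinity.\<close>
  then obtain j1 where j1: "p j1 \<noteq> 0" "Polynomial.degree (p j1) = e" by (auto simp: J_def)
  have all: "pclass (\<lambda>j. poly (p j) s) \<in> all_points" "pclass (\<lambda>j. Polynomial.coeff (p j) e) \<in> all_points" for s
  proof -
    have "pclass (\<lambda>j. poly (p j) s) \<in> PS N" using nz p0 by (intro PS_I) auto
    moreover have "pclass (\<lambda>j. Polynomial.coeff (p j) e) \<in> PS N"
      using j1 p0 by (intro PS_I) (auto intro!: exI[of _ j1])
    ultimately show "pclass (\<lambda>j. poly (p j) s) \<in> all_points" "pclass (\<lambda>j. Polynomial.coeff (p j) e) \<in> all_points"
      using PS_subset_all_points by blast+
  qed
  have BA: "pclass (\<lambda>j. eval2 (B j) u s) = pclass (\<lambda>j. eval2 (A j) u s)" if "u \<noteq> 0" for u s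
    unfolding evAB using that by (simp add: pclass_scale)
  obtain S where S: "\<And>F. F \<in> S \<Longrightarrow> \<exists>d. homogeneous_of d F" "V = zero_locus S"
    using closedin_zariski_zero_locus[OF closed] by metis
  \<comment> \<open>The form vanishes along the arcs for u \<noteq> 0, hence in the limit.
    Homogeneity lets the factor \<open>poly c s\<close> be removed where it is nonzero, and a
    polynomial identity then covers the roots of \<open>c\<close> and the point at infinity as
    well.\<close>
  have zero: "subst_poly p F = 0" if F: "F \<in> S" for F
  proof (rule poly_eqI_cofinite)
    obtain d where d: "homogeneous_of d F" using S(1)[OF F] by blast
    from eval2_generically_nonzero[OF H] eventually_cofinite_poly_nonzero[OF c]
    show "\<forall>\<^sub>F s in cofinite. poly (subst_poly p F) s = poly 0 s"
    proof eventually_elim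
      case (elim s)
      have "\<forall>\<^sub>F u in at 0. u \<noteq> (0::complex)" by (rule eventually_neq_at_within)
      with elim(1) have "\<forall>\<^sub>F u in at 0. peval F (\<lambda>j. eval2 (B j) u s) = 0"
      proof eventually_elim
        case (elim u)
        then have "pclass (\<lambda>j. eval2 (B j) u s) \<in> zero_locus S" using A BA S(2) by simp
        then show ?case using F pclass_self unfolding zero_locus_eq by blast
      qed
      then have "((\<lambda>u. peval F (\<lambda>j. eval2 (B j) u s)) \<longlongrightarrow> 0) (at 0)"
        by (rule tendsto_eventually)
      moreover have "((\<lambda>u. peval F (\<lambda>j. eval2 (B j) u s)) \<longlongrightarrow> peval F (\<lambda>j. eval2 (B j) 0 s)) (at 0)"
        by (rule tendsto_peval) (rule tendsto_eval2)
      ultimately have "peval F (\<lambda>j. poly c s * poly (p j) s) = 0"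
        unfolding B0 using tendsto_unique[of "at (0::complex)"] by (simp add: at_neq_bot)
      then show ?case using peval_scale[OF d] elim(2) by (simp add: poly_subst_poly)
    qed
  qed
  have "rational_curve V p e"
  proof
    show "V \<subseteq> all_points" by (rule Va)
    show "Polynomial.degree (p j) \<le> e" for j by (rule deg)
    show "pclass (\<lambda>j. poly (p j) s) \<in> V" for s
      unfolding S(2)
    proof (rule pclass_in_zero_locus[OF S(1) _ all(1)])
      show "peval F (\<lambda>j. poly (p j) s) = 0" if "F \<in> S" for F
        using zero[OF that] poly_subst_poly[of p F s] by simp
    qed
    show "pclass (\<lambda>j. Polynomial.coeff (p j) e) \<in> V"
      unfolding S(2)
    proof (rule pclass_in_zero_locus[OF S(1) _ all(2)])
      fix F assume F: "F \<in> S"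
      obtain d where "homogeneous_of d F" using S(1)[OF F] by blast
      from subst_poly_homogeneous(2)[of p e, OF deg this]
      show "peval F (\<lambda>j. Polynomial.coeff (p j) e) = 0" using zero[OF F] by simp
    qed
  qed
  then have "lifted_line V p e \<pi> B c H"
    unfolding lifted_line_def lifted_line_axioms_def using c H B0 A BA by simp
  then show ?thesis by blast
qed

context lifted_line
begin

section \<open>Limits along arcs that meet the line at infinity\<close>

text \<open>Continuity of \<open>f\<close> along the arcs u -> 0, in homogeneous coordinates. The
  proof stays with polynomials: near the general point of the curve the ratios of coordinates are
  quotients of forms, and the resulting identities pass to the limit.\<close>

lemma specialization:
  assumes f: "morphism V (PS n) f"
    and R: "\<forall>\<^sub>F s in cofinite. \<forall>\<^sub>F u in at 0. f (pclass (\<lambda>j. eval2 (B j) u s)) = pclass (R u s)"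
    and lim: "\<And>s j. ((\<lambda>u. R u s j) \<longlongrightarrow> R0 s j) (at 0)"
    and R0: "\<forall>\<^sub>F s in cofinite. \<exists>j. R0 s j \<noteq> 0" "\<And>s j. j > n \<Longrightarrow> R0 s j = 0"
  shows "\<forall>\<^sub>F s in cofinite. f (cpt s) = pclass (R0 s)"
proof -
  have fp: "f q \<in> PS n" if "q \<in> V" for q
    using morphism_image[OF f V_subset PS_subset_all_points that] .
  have fa: "f q \<in> all_points" if "q \<in> V" for q
    using fp[OF that] PS_subset_all_points by blast
  obtain v0 where v0: "v0 \<in> f (cpt 0)" using all_points_D(1)[OF fa[OF cpt_in]] by blast
  obtain i where i: "v0 i \<noteq> 0" using all_points_D(3)[OF fa[OF cpt_in] v0] by blast
  obtain F G \<delta> where "near V (cpt 0) (\<lambda>q. (\<forall>w\<in>f q. w i \<noteq> 0) \<and>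
      (\<forall>j\<le>n. \<forall>v\<in>q. peval (G j) v \<noteq> 0 \<and> (\<forall>w\<in>f q. w j / w i = peval (F j) v / peval (G j) v)))"
    using morphism_near[OF f V_subset PS_subset_all_points cpt_in v0 i, of n] by (elim exE conjE)
  then obtain K d where K: "homogeneous_of d K" "cpt 0 \<in> nonvanishing K"
    and Kw: "\<And>q w. q \<in> V \<Longrightarrow> q \<in> nonvanishing K \<Longrightarrow> w \<in> f q \<Longrightarrow> w i \<noteq> 0"
    and KG: "\<And>q v j. q \<in> V \<Longrightarrow> q \<in> nonvanishing K \<Longrightarrow> v \<in> q \<Longrightarrow> j \<le> n \<Longrightarrow> peval (G j) v \<noteq> 0"
    and KF: "\<And>q v w j. q \<in> V \<Longrightarrow> q \<in> nonvanishing K \<Longrightarrow> v \<in> q \<Longrightarrow> w \<in> f q \<Longrightarrow> j \<le> n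
      \<Longrightarrow> w j / w i = peval (F j) v / peval (G j) v"
    unfolding near_def by (elim exE conjE) simp
  have "subst_poly p K \<noteq> 0" using subst_poly_nonzero[OF K(1) _ K(2)] by simp
  from eventually_cofinite_poly_nonzero[OF this] eventually_cofinite_poly_nonzero[OF c_nonzero]
    eval2_generically_nonzero[OF H_nonzero] R R0(1)
  show ?thesis
  proof eventually_elim
    case (elim s)
    define b where "b u = (\<lambda>j. eval2 (B j) u s)" for u
    have b0: "b 0 = (\<lambda>j. poly c s * poly (p j) s)" by (simp add: b_def B_at_0)
    have tb: "((\<lambda>u. peval E (b u)) \<longlongrightarrow> peval E (b 0)) (at 0)" for E
      unfolding b_def by (rule tendsto_peval) (rule tendsto_eval2)
    have "b 0 \<in> cpt s" unfolding b0 cpt_def mem_pclass_iff using elim(2) by blast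
    have "peval K (b 0) = poly c s ^ d * poly (subst_poly p K) s"
      unfolding b0 poly_subst_poly using peval_scale[OF K(1)] by simp
    then have Kb: "peval K (b 0) \<noteq> 0" using elim(1,2) by simp
    have cs: "cpt s \<in> nonvanishing K"
      using elim(1) nonvanishing_pclass[OF K(1)] unfolding cpt_def poly_subst_poly by simp
    \<comment> \<open>Denominators are cleared before taking limits, as it is not yet known that the
      limit of \<open>R u s i\<close> is nonzero.\<close>
    have ev: "\<forall>\<^sub>F u in at 0. \<forall>j\<le>n. R u s j * peval (G j) (b u) = R u s i * peval (F j) (b u)"
      using elim(3,4) tendsto_imp_eventually_ne[OF tb Kb] eventually_neq_at_within[of 0 0 UNIV]
    proof eventually_elim
      case (elim u)
      have q: "pclass (b u) \<in> V" using B_in[OF elim(4) elim(1)] by (simp add: b_def)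
      have Kq: "pclass (b u) \<in> nonvanishing K" using elim(3) nonvanishing_pclass[OF K(1)] by simp
      have Rf: "R u s \<in> f (pclass (b u))" using elim(2) pclass_self by (simp add: b_def)
      show ?case
        using Kw[OF q Kq Rf] KG[OF q Kq pclass_self] KF[OF q Kq pclass_self Rf]
        by (simp add: field_simps)
    qed
    have cross: "R0 s j * peval (G j) (b 0) = R0 s i * peval (F j) (b 0)" if "j \<le> n" for j
    proof (rule tendsto_unique[of "at (0::complex)"])
      show "((\<lambda>u. R u s j * peval (G j) (b u)) \<longlongrightarrow> R0 s j * peval (G j) (b 0)) (at 0)"
        by (intro tendsto_mult lim tb)
      have "((\<lambda>u. R u s i * peval (F j) (b u)) \<longlongrightarrow> R0 s i * peval (F j) (b 0)) (at 0)"
        by (intro tendsto_mult lim tb)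
      then show "((\<lambda>u. R u s j * peval (G j) (b u)) \<longlongrightarrow> R0 s i * peval (F j) (b 0)) (at 0)"
        by (rule Lim_transform_eventually) (use ev in eventually_elim, use that in simp)
    qed (simp add: at_neq_bot)
    obtain w where w: "w \<in> f (cpt s)" using all_points_D(1)[OF fa[OF cpt_in]] by blast
    have wi: "w i \<noteq> 0" using Kw[OF cpt_in cs w] .
    have R0w: "R0 s j = R0 s i / w i * w j" for j
    proof (cases "j \<le> n")
      case True
      have "w j = w i * peval (F j) (b 0) / peval (G j) (b 0)"
        using KF[OF cpt_in cs \<open>b 0 \<in> cpt s\<close> w True] wi by (simp add: field_simps)
      moreover have "R0 s j = R0 s i * peval (F j) (b 0) / peval (G j) (b 0)"
        using cross[OF True] KG[OF cpt_in cs \<open>b 0 \<in> cpt s\<close> True] by (simp add: field_simps)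
      ultimately show ?thesis using wi by simp
    next
      case False
      then show ?thesis using R0(2)[of j s] PS_D(3)[OF fp[OF cpt_in] w] by simp
    qed
    \<comment> \<open>All coordinates of \<open>R0 s\<close> are multiples of this one, and they do
      not all vanish.\<close>
    then have "R0 s i \<noteq> 0" using elim(5) by (metis div_0 mult_zero_left)
    have "R0 s = (\<lambda>j. R0 s i / w i * w j)" using R0w by (rule ext)
    then have "pclass (R0 s) = pclass w"
      using pclass_scale[of "R0 s i / w i" w] \<open>R0 s i \<noteq> 0\<close> wi by simp
    then show "f (cpt s) = pclass (R0 s)" using all_points_D(2)[OF fa[OF cpt_in] w] by simp
  qed
qed

lemma tendsto_hvec:
  assumes "(X \<longlongrightarrow> x) F" "(Y \<longlongrightarrow> y) F" "(Z \<longlongrightarrow> z) F"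
  shows "((\<lambda>u. hvec (X u) (Y u) (Z u) j) \<longlongrightarrow> hvec x y z j) F"
  using assms by (simp add: hvec_def)

text \<open>The curve is generically a section of \<pi> over the line at infinity, which identifies
  it as the strict transform of that line.\<close>

lemma \<pi>_cpt:
  assumes "morphism V (PS 2) \<pi>"
  shows "\<forall>\<^sub>F s in cofinite. \<pi> (cpt s) = pclass (hvec 0 s 1)"
proof (rule specialization[OF assms])
  from eval2_generically_nonzero[OF H_nonzero]
  show "\<forall>\<^sub>F s in cofinite. \<forall>\<^sub>F u in at 0. \<pi> (pclass (\<lambda>j. eval2 (B j) u s)) = pclass (hvec u s 1)"
  proof eventually_elim
    case (elim s)
    with eventually_neq_at_within[of 0 0 UNIV] show ?case
      by eventually_elim (rule \<pi>_B)
  qed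
  show "((\<lambda>u. hvec u s 1 j) \<longlongrightarrow> hvec 0 s 1 j) (at 0)" for s j
    by (intro tendsto_hvec tendsto_intros)
  show "\<forall>\<^sub>F s in cofinite. \<exists>j. hvec 0 s 1 j \<noteq> 0"
    by (intro always_eventually allI exI[of _ 2]) (simp add: hvec_def)
  show "hvec 0 s 1 j = 0" if "j > 2" for s j using that by (simp add: hvec_def)
qed

lemma \<pi>_cpt_not_constant:
  assumes "morphism V (PS 2) \<pi>"
  shows "\<not> (\<forall>\<^sub>F s in cofinite. \<pi> (cpt s) = q)"
proof
  assume "\<forall>\<^sub>F s in cofinite. \<pi> (cpt s) = q"
  with \<pi>_cpt[OF assms] have ev: "\<forall>\<^sub>F s in cofinite. q = pclass (hvec 0 s 1)"
    by eventually_elim simp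
  then obtain t where t: "q = pclass (hvec 0 t 1)" by (rule eventually_cofinite_ex)
  have "\<forall>\<^sub>F s in cofinite. s \<noteq> t" by (simp add: eventually_cofinite)
  with ev have "\<forall>\<^sub>F s in cofinite. q = pclass (hvec 0 s 1) \<and> s \<noteq> t" by (rule eventually_conj)
  then obtain s where s: "q = pclass (hvec 0 s 1)" "s \<noteq> t" by (rule eventually_cofinite_ex) auto
  have "hvec 0 s 1 \<in> pclass (hvec 0 t 1)" using s(1) t pclass_self by metis
  then obtain b where b: "hvec 0 s 1 = (\<lambda>i. b * hvec 0 t 1 i)" by (auto simp: mem_pclass_iff)
  have "s = t" using fun_cong[OF b, of 1] fun_cong[OF b, of 2] by (simp add: hvec_def)
  then show False using s(2) by simp
qed

end

section \<open>Leading forms of plane automorphisms\<close>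

text \<open>Here \<open>hvec x y 0\<close> holds the two affine variables, of index 0 and 1, and not
  projective coordinates. If \<open>d\<close> exceeds the degree of \<open>F\<close> the value is 0,
  so one \<open>d\<close> can serve both components of a map.\<close>

definition top_form :: "nat \<Rightarrow> mpoly \<Rightarrow> complex \<Rightarrow> complex \<Rightarrow> complex" where
  "top_form d F x y = (\<Sum>m\<in>{m \<in> Poly_Mapping.keys F. mono_degree m = d}.
     Poly_Mapping.lookup F m * mono_eval m (hvec x y 0))"

text \<open>For bivariate \<open>F\<close> this is the leading form dehomogenised at y = 1.\<close>

definition top_poly :: "nat \<Rightarrow> mpoly \<Rightarrow> complex poly" where
  "top_poly d F = (\<Sum>m\<in>{m \<in> Poly_Mapping.keys F. mono_degree m = d}.
     Polynomial.monom (Poly_Mapping.lookup F m) (Poly_Mapping.lookup m 0))"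

lemma mono_degree_le_total_degree: "m \<in> Poly_Mapping.keys F \<Longrightarrow> mono_degree m \<le> total_degree F"
  by (simp add: total_degree_def)

lemma mono_eval_scale: "mono_eval m (\<lambda>i. c * v i) = c ^ mono_degree m * mono_eval m v"
  by (simp add: mono_eval_def mono_degree_def power_mult_distrib prod.distrib power_sum)

lemma hvec_scale: "hvec (c * x) (c * y) 0 = (\<lambda>i. c * hvec x y 0 i)"
  by (auto simp: hvec_def fun_eq_iff)

lemma top_form_scale: "top_form d F (c * x) (c * y) = c ^ d * top_form d F x y"
proof -
  have "top_form d F (c * x) (c * y) = (\<Sum>m\<in>{m \<in> Poly_Mapping.keys F. mono_degree m = d}.
     c ^ d * (Poly_Mapping.lookup F m * mono_eval m (hvec x y 0)))"
    unfolding top_form_def hvec_scale mono_eval_scale by (rule sum.cong) auto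
  then show ?thesis by (simp add: top_form_def sum_distrib_left)
qed

text \<open>A monomial of degree k keeps the factor \<open>t u\<close> to the power
  \<open>d - k\<close>, which tends to 0 unless k = \<open>d\<close>. The scale \<open>t\<close> is
  general because it is u for the automorphism itself but a power of u for a composite.\<close>

lemma tendsto_top_form:
  assumes X: "(X \<longlongrightarrow> x) A" and Y: "(Y \<longlongrightarrow> y) A" and t: "(t \<longlongrightarrow> 0) A" "\<forall>\<^sub>F u in A. t u \<noteq> 0"
    and d: "total_degree F \<le> d"
  shows "((\<lambda>u. t u ^ d * peval F (hvec (X u / t u) (Y u / t u) 0)) \<longlongrightarrow> top_form d F x y) A"
proof -
  have mono: "((\<lambda>u. mono_eval m (hvec (X u) (Y u) 0)) \<longlongrightarrow> mono_eval m (hvec x y 0)) A" for m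
    unfolding mono_eval_def by (intro tendsto_intros) (auto simp: hvec_def X Y)
  have "((\<lambda>u. \<Sum>m\<in>Poly_Mapping.keys F. Poly_Mapping.lookup F m *
        (t u ^ (d - mono_degree m) * mono_eval m (hvec (X u) (Y u) 0))) \<longlongrightarrow>
      (\<Sum>m\<in>Poly_Mapping.keys F. Poly_Mapping.lookup F m *
        (0 ^ (d - mono_degree m) * mono_eval m (hvec x y 0)))) A"
    by (intro tendsto_intros mono t)
  also have "(\<Sum>m\<in>Poly_Mapping.keys F. Poly_Mapping.lookup F m *
        (0 ^ (d - mono_degree m) * mono_eval m (hvec x y 0))) = top_form d F x y"
    unfolding top_form_def
  proof (rule sum.mono_neutral_cong_right)
    show "\<forall>m\<in>Poly_Mapping.keys F - {m \<in> Poly_Mapping.keys F. mono_degree m = d}.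
        Poly_Mapping.lookup F m * (0 ^ (d - mono_degree m) * mono_eval m (hvec x y 0)) = 0"
    proof
      fix m assume "m \<in> Poly_Mapping.keys F - {m \<in> Poly_Mapping.keys F. mono_degree m = d}"
      then have "mono_degree m < d" using mono_degree_le_total_degree[of m F] d by auto
      then show "Poly_Mapping.lookup F m * (0 ^ (d - mono_degree m) * mono_eval m (hvec x y 0)) = 0"
        by (simp add: power_0_left)
    qed
  qed auto
  finally have lim: "((\<lambda>u. \<Sum>m\<in>Poly_Mapping.keys F. Poly_Mapping.lookup F m *
        (t u ^ (d - mono_degree m) * mono_eval m (hvec (X u) (Y u) 0))) \<longlongrightarrow> top_form d F x y) A" .
  have ev: "\<forall>\<^sub>F u in A. (\<Sum>m\<in>Poly_Mapping.keys F. Poly_Mapping.lookup F m *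
        (t u ^ (d - mono_degree m) * mono_eval m (hvec (X u) (Y u) 0)))
      = t u ^ d * peval F (hvec (X u / t u) (Y u / t u) 0)"
    using t(2)
  proof eventually_elim
    case (elim u)
    have "t u ^ (d - mono_degree m) * mono_eval m (hvec (X u) (Y u) 0)
        = t u ^ d * mono_eval m (hvec (X u / t u) (Y u / t u) 0)" if "m \<in> Poly_Mapping.keys F" for m
    proof -
      have "mono_degree m \<le> d" using mono_degree_le_total_degree[OF that] d by simp
      then have "t u ^ d = t u ^ (d - mono_degree m) * t u ^ mono_degree m"
        by (simp add: power_add[symmetric])
      moreover have "mono_eval m (hvec (X u) (Y u) 0)
          = t u ^ mono_degree m * mono_eval m (hvec (X u / t u) (Y u / t u) 0)"
        unfolding mono_eval_scale[symmetric] hvec_scale[symmetric] using elim by simp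
      ultimately show ?thesis by simp
    qed
    then show ?case
      unfolding peval_def sum_distrib_left by (intro sum.cong) (auto simp: mult.left_commute)
  qed
  show ?thesis by (rule Lim_transform_eventually[OF lim ev])
qed

lemma mono_eval_two_variables:
  assumes "Poly_Mapping.keys m \<subseteq> {0, 1}"
  shows "mono_eval m v = v 0 ^ Poly_Mapping.lookup m 0 * v 1 ^ Poly_Mapping.lookup m 1"
  using mono_eval_superset[of "{0, 1}" m v] assms by simp

lemma poly_top_poly:
  assumes "pvars F \<subseteq> {0, 1}"
  shows "poly (top_poly d F) s = top_form d F s 1"
  unfolding top_poly_def top_form_def poly_sum
proof (rule sum.cong)
  fix m assume "m \<in> {m \<in> Poly_Mapping.keys F. mono_degree m = d}"
  then have "Poly_Mapping.keys m \<subseteq> {0, 1}" using assms by (auto simp: pvars_def)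
  from mono_eval_two_variables[OF this]
  show "poly (Polynomial.monom (Poly_Mapping.lookup F m) (Poly_Mapping.lookup m 0)) s
      = Poly_Mapping.lookup F m * mono_eval m (hvec s 1 0)"
    by (simp add: poly_monom hvec_def)
qed simp

text \<open>A bivariate monomial of given degree is determined by its first exponent, so
  dehomogenising causes no cancellation. Positivity of \<open>d\<close> excludes
  \<open>F = 0\<close>, whose total degree is 0 by convention.\<close>

lemma top_poly_nonzero:
  assumes F: "pvars F \<subseteq> {0, 1}" and d: "total_degree F = d" "d > 0"
  shows "top_poly d F \<noteq> 0"
proof -
  have "total_degree F \<in> insert 0 (mono_degree ` Poly_Mapping.keys F)"
    unfolding total_degree_def by (rule Max_in) auto
  then obtain m where m: "m \<in> Poly_Mapping.keys F" "mono_degree m = d" using d by auto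
  have vars: "Poly_Mapping.keys n \<subseteq> {0, 1}" if "n \<in> Poly_Mapping.keys F" for n
    using F that by (auto simp: pvars_def)
  have deg: "mono_degree n = Poly_Mapping.lookup n 0 + Poly_Mapping.lookup n 1" if "n \<in> Poly_Mapping.keys F" for n
    using mono_degree_superset[of "{0, 1}" n] vars[OF that] by simp
  have inj: "n = m" if n: "n \<in> Poly_Mapping.keys F" "mono_degree n = d"
      and eq: "Poly_Mapping.lookup n 0 = Poly_Mapping.lookup m 0" for n
  proof (rule poly_mapping_eqI)
    fix i
    show "Poly_Mapping.lookup n i = Poly_Mapping.lookup m i"
    proof (cases "i \<in> {0, 1}")
      case True
      then show ?thesis using deg[OF n(1)] deg[OF m(1)] n(2) m(2) eq by auto
    next
      case False
      then have "i \<notin> Poly_Mapping.keys n" "i \<notin> Poly_Mapping.keys m" using vars n(1) m(1) by blast+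
      then show ?thesis by (simp add: in_keys_iff)
    qed
  qed
  have "Polynomial.coeff (top_poly d F) (Poly_Mapping.lookup m 0)
      = (\<Sum>n\<in>{n \<in> Poly_Mapping.keys F. mono_degree n = d}. if n = m then Poly_Mapping.lookup F m else 0)"
    unfolding top_poly_def coeff_sum by (rule sum.cong) (use inj in auto)
  also have "\<dots> = Poly_Mapping.lookup F m" using m by simp
  also have "\<dots> \<noteq> 0" using m by (simp add: in_keys_iff)
  finally show ?thesis by auto
qed

lemma peval_constant:
  assumes "total_degree F = 0"
  shows "peval F v = peval F w"
proof -
  have "mono_eval m v = mono_eval m w" if "m \<in> Poly_Mapping.keys F" for m
  proof -
    have "mono_degree m = 0" using mono_degree_le_total_degree[OF that] assms by simp
    then have "\<forall>i\<in>Poly_Mapping.keys m. Poly_Mapping.lookup m i = 0" by (simp add: mono_degree_def)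
    then have "Poly_Mapping.keys m = {}" by (meson all_not_in_conv in_keys_iff)
    then show ?thesis by (simp add: mono_eval_def)
  qed
  then show ?thesis by (simp add: peval_def)
qed

lemma polynomial_map_eq:
  "polynomial_map P (x, y) = (peval (fst P) (hvec x y 0), peval (snd P) (hvec x y 0))"
proof -
  have "(\<lambda>i. if i = 0 then x else if i = 1 then y else 0) = hvec x y 0"
    by (auto simp: hvec_def fun_eq_iff)
  then show ?thesis by (simp add: polynomial_map_def Let_def)
qed

text \<open>A constant map cannot be surjective.\<close>

lemma algebraic_degree_pos:
  assumes "polynomial_map Q \<circ> polynomial_map P = id"
  shows "algebraic_degree Q > 0"
proof (rule ccontr)
  assume "\<not> algebraic_degree Q > 0"
  then have "total_degree (fst Q) = 0" "total_degree (snd Q) = 0" by (auto simp: algebraic_degree_def)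
  then have "polynomial_map Q z = polynomial_map Q z'" for z z'
    using peval_constant by (cases z; cases z') (simp add: polynomial_map_eq)
  moreover have "polynomial_map Q (polynomial_map P z) = z" for z
    using fun_cong[OF assms, of z] by simp
  ultimately have "(0, 0) = (1 :: complex, 1 :: complex)" by metis
  then show False by simp
qed

lemma algebraic_degree_cases:
  assumes P: "bivariate_pair P" and d: "algebraic_degree P = d" "d > 0"
  obtains F where "F \<in> {fst P, snd P}" "top_poly d F \<noteq> 0"
proof -
  have "total_degree (fst P) = d \<or> total_degree (snd P) = d"
    using d by (auto simp: algebraic_degree_def max_def split: if_splits)
  moreover have "pvars (fst P) \<subseteq> {0, 1}" "pvars (snd P) \<subseteq> {0, 1}"
    using P by (simp_all add: bivariate_pair_def)
  ultimately have "top_poly d (fst P) \<noteq> 0 \<or> top_poly d (snd P) \<noteq> 0"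
    using top_poly_nonzero d(2) by metis
  then show ?thesis using that by auto
qed

text \<open>The leading form of \<open>Q\<close> composed with that of \<open>P\<close> is the part of degree \<open>d * e > 1\<close> of
  \<open>Q \<circ> P = id\<close>.\<close>

lemma top_form_composition:
  assumes QP: "polynomial_map Q \<circ> polynomial_map P = id"
    and de: "algebraic_degree P = d" "algebraic_degree Q = e" "d * e \<ge> 2"
    and F: "F \<in> {fst Q, snd Q}"
  shows "top_form e F (top_form d (fst P) s 1) (top_form d (snd P) s 1) = 0"
proof (rule tendsto_unique[of "at (0::complex)"])
  have d: "d > 0" using de(3) by (cases d) auto
  let ?X = "\<lambda>G u. u ^ d * peval G (hvec (s / u) (1 / u) 0)"
  have nz: "\<forall>\<^sub>F u in at 0. u \<noteq> (0::complex)" by (rule eventually_neq_at_within)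
  have X: "(?X G \<longlongrightarrow> top_form d G s 1) (at 0)" if "total_degree G \<le> d" for G
    by (rule tendsto_top_form[OF _ _ _ _ that]) (use nz in \<open>auto intro!: tendsto_eq_intros\<close>)
  have "total_degree F \<le> e" "total_degree (fst P) \<le> d" "total_degree (snd P) \<le> d"
    using F de by (auto simp: algebraic_degree_def)
  moreover have "((\<lambda>u::complex. u ^ d) \<longlongrightarrow> 0) (at 0)"
    using d by (auto intro!: tendsto_eq_intros simp: power_0_left)
  moreover have "\<forall>\<^sub>F u in at 0. u ^ d \<noteq> (0::complex)" using nz by eventually_elim simp
  ultimately show "((\<lambda>u. (u ^ d) ^ e * peval F (hvec (?X (fst P) u / u ^ d) (?X (snd P) u / u ^ d) 0)) \<longlongrightarrow>
      top_form e F (top_form d (fst P) s 1) (top_form d (snd P) s 1)) (at 0)"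
    by (intro tendsto_top_form X)
  \<comment> \<open>\<open>F\<close> composed with the other map returns a coordinate of (s / u, 1 /
    u), namely \<open>b / u\<close>. Scaling by u to the power \<open>d * e\<close> leaves the
    exponent \<open>d * e - 1\<close>, which is at least 1, so the limit is 0.\<close>
  define b where "b = (if F = fst Q then s else 1)"
  have zero: "0 ^ (d * e - 1) * b = 0" using de(3) by (simp add: power_0_left)
  have "((\<lambda>u. u ^ (d * e - 1) * b) \<longlongrightarrow> 0 ^ (d * e - 1) * b) (at 0)"
    by (intro tendsto_intros)
  then have "((\<lambda>u. u ^ (d * e - 1) * b) \<longlongrightarrow> 0) (at 0)" unfolding zero .
  moreover have "\<forall>\<^sub>F u in at 0. u ^ (d * e - 1) * b =
      (u ^ d) ^ e * peval F (hvec (?X (fst P) u / u ^ d) (?X (snd P) u / u ^ d) 0)"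
    using nz
  proof eventually_elim
    case (elim u)
    have "polynomial_map Q (polynomial_map P (s / u, 1 / u)) = (s / u, 1 / u)"
      using fun_cong[OF QP, of "(s / u, 1 / u)"] by simp
    then have "peval F (hvec (peval (fst P) (hvec (s / u) (1 / u) 0)) (peval (snd P) (hvec (s / u) (1 / u) 0)) 0) = b / u"
      using F by (auto simp: polynomial_map_eq b_def)
    moreover have "(u ^ d) ^ e = u ^ (d * e - 1) * u"
      using de(3) by (cases "d * e") (simp_all add: power_mult[symmetric])
    ultimately show ?case using elim by simp
  qed
  ultimately show "((\<lambda>u. (u ^ d) ^ e * peval F (hvec (?X (fst P) u / u ^ d) (?X (snd P) u / u ^ d) 0)) \<longlongrightarrow> 0) (at 0)"
    by (rule Lim_transform_eventually)
qed (simp add: at_neq_bot)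

lemma affine_point_eq: "affine_point (x, y) = pclass (hvec 1 x y)"
proof -
  have "(\<lambda>i. if i = 0 then 1 else if i = 1 then x else if i = 2 then y else 0) = hvec 1 x y"
    by (auto simp: hvec_def fun_eq_iff)
  then show ?thesis by (simp add: affine_point_def)
qed

lemma hvec_scale3: "(\<lambda>i. c * hvec x y z i) = hvec (c * x) (c * y) (c * z)"
  by (auto simp: hvec_def fun_eq_iff)

section \<open>The ample index\<close>

context lifted_line
begin

lemma automorphism_contracts_line:
  assumes P: "bivariate_pair P" and Q: "bivariate_pair Q"
    and QP: "polynomial_map Q \<circ> polynomial_map P = id"
    and de: "algebraic_degree P = d" "algebraic_degree Q = e'" "d * e' \<ge> 2"
    and f: "represents_composite V (polynomial_map P) \<pi> f"
  shows "\<exists>q. \<forall>\<^sub>F s in cofinite. f (cpt s) = q"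
proof -
  have f': "morphism V (PS 2) f" and rep: "\<And>q z. q \<in> V \<Longrightarrow> \<pi> q = affine_point z \<Longrightarrow> f q = affine_point (polynomial_map P z)"
    using f unfolding represents_composite_def by blast+
  have pos: "d > 0" "e' > 0" using de(3) by (cases d; cases e'; simp)+
  define a b where "a s = top_form d (fst P) s 1" and "b s = top_form d (snd P) s 1" for s
  \<comment> \<open>Homogeneous coordinates of the image of (s / u, 1 / u), the affine point with
    coordinates (u : s : 1), scaled so that they stay finite as u -> 0.\<close>
  define R where "R u s = hvec (u ^ d) (u ^ d * peval (fst P) (hvec (s / u) (1 / u) 0))
      (u ^ d * peval (snd P) (hvec (s / u) (1 / u) 0))" for u s
  have nz: "\<forall>\<^sub>F u in at 0. u \<noteq> (0::complex)" by (rule eventually_neq_at_within)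
  \<comment> \<open>Some component attains the degree \<open>d\<close>, so the limit of
    \<open>R\<close> is a genuine projective point for general s.\<close>
  have ab: "\<forall>\<^sub>F s in cofinite. a s \<noteq> 0 \<or> b s \<noteq> 0"
  proof -
    obtain F where F: "F \<in> {fst P, snd P}" "top_poly d F \<noteq> 0"
      using algebraic_degree_cases[OF P de(1) pos(1)] .
    have "pvars F \<subseteq> {0, 1}" using F(1) P by (auto simp: bivariate_pair_def)
    from eventually_cofinite_poly_nonzero[OF F(2)] show ?thesis
      by eventually_elim (use F(1) poly_top_poly[OF \<open>pvars F \<subseteq> {0, 1}\<close>] in \<open>auto simp: a_def b_def\<close>)
  qed
  have image: "\<forall>\<^sub>F s in cofinite. f (cpt s) = pclass (hvec 0 (a s) (b s))"
  proof (rule specialization[OF f', where R = R])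
    from eval2_generically_nonzero[OF H_nonzero]
    show "\<forall>\<^sub>F s in cofinite. \<forall>\<^sub>F u in at 0. f (pclass (\<lambda>j. eval2 (B j) u s)) = pclass (R u s)"
    proof eventually_elim
      case (elim s)
      with nz show ?case
      proof eventually_elim
        case (elim u)
        have "pclass (hvec u s 1) = affine_point (s / u, 1 / u)"
          unfolding affine_point_eq using pclass_scale[of u "hvec 1 (s / u) (1 / u)"] elim(1)
          by (simp add: hvec_scale3)
        then have "f (pclass (\<lambda>j. eval2 (B j) u s)) = affine_point (polynomial_map P (s / u, 1 / u))"
          using rep[OF B_in[OF elim]] \<pi>_B[OF elim] by simp
        also have "\<dots> = pclass (R u s)"
          unfolding polynomial_map_eq affine_point_eq R_def
          using pclass_scale[of "u ^ d" "hvec 1 (peval (fst P) (hvec (s / u) (1 / u) 0))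
            (peval (snd P) (hvec (s / u) (1 / u) 0))"] elim(1)
          by (simp add: hvec_scale3)
        finally show ?case .
      qed
    qed
    have X: "((\<lambda>u. u ^ d * peval G (hvec (s / u) (1 / u) 0)) \<longlongrightarrow> top_form d G s 1) (at 0)"
      if "G \<in> {fst P, snd P}" for G s
    proof (rule tendsto_top_form)
      show "total_degree G \<le> d" using that de(1) by (auto simp: algebraic_degree_def)
    qed (use nz in \<open>auto intro!: tendsto_eq_intros\<close>)
    have "((\<lambda>u::complex. u ^ d) \<longlongrightarrow> 0) (at 0)"
      using pos by (auto intro!: tendsto_eq_intros simp: power_0_left)
    then show "((\<lambda>u. R u s j) \<longlongrightarrow> hvec 0 (a s) (b s) j) (at 0)" for s j
      unfolding R_def a_def b_def by (intro tendsto_hvec X) auto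
    show "\<forall>\<^sub>F s in cofinite. \<exists>j. hvec 0 (a s) (b s) j \<noteq> 0"
      using ab
    proof eventually_elim
      case (elim s)
      then have "hvec 0 (a s) (b s) 1 \<noteq> 0 \<or> hvec 0 (a s) (b s) 2 \<noteq> 0" by (simp add: hvec_def)
      then show ?case by blast
    qed
    show "hvec 0 (a s) (b s) j = 0" if "j > 2" for s j using that by (simp add: hvec_def)
  qed
  obtain T where T: "T \<in> {fst Q, snd Q}" "top_poly e' T \<noteq> 0"
    using algebraic_degree_cases[OF Q de(2) pos(2)] .
  have T_vars: "pvars T \<subseteq> {0, 1}" using T(1) Q by (auto simp: bivariate_pair_def)
  \<comment> \<open>The dehomogenised form cannot see (0 : 1 : 0), so this point is added whether or
    not it is a zero; only finiteness matters.\<close>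
  define S where "S = insert (pclass (hvec 0 1 0)) ((\<lambda>r. pclass (hvec 0 r 1)) ` {r. poly (top_poly e' T) r = 0})"
  have "finite S" unfolding S_def using poly_roots_finite[OF T(2)] by simp
  moreover have "\<forall>\<^sub>F s in cofinite. f (cpt s) \<in> S"
    using image ab
  proof eventually_elim
    case (elim s)
    show ?case
    proof (cases "b s = 0")
      case True
      then have "a s \<noteq> 0" using elim(2) by simp
      then have "pclass (hvec 0 (a s) (b s)) = pclass (hvec 0 1 0)"
        using pclass_scale[of "a s" "hvec 0 1 0"] True by (simp add: hvec_scale3)
      then show ?thesis using elim(1) by (simp add: S_def)
    next
      case False
      have "top_form e' T (a s) (b s) = 0"
        unfolding a_def b_def by (rule top_form_composition[OF QP de T(1)])
      then have "b s ^ e' * top_form e' T (a s / b s) 1 = 0"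
        using False by (simp add: top_form_scale[symmetric])
      then have "poly (top_poly e' T) (a s / b s) = 0" using False poly_top_poly[OF T_vars] by simp
      moreover have "pclass (hvec 0 (a s) (b s)) = pclass (hvec 0 (a s / b s) 1)"
        using pclass_scale[of "b s" "hvec 0 (a s / b s) 1"] False by (simp add: hvec_scale3)
      ultimately show ?thesis using elim(1) by (auto simp: S_def)
    qed
  qed
  ultimately show ?thesis by (rule constant_of_finitely_many_values[OF f'])
qed

lemma ample_D_class_negative:
  assumes \<pi>: "morphism V (PS 2) \<pi>"
    and f: "morphism V (PS 2) (composite_morphism V \<phi> \<pi>)"
      "\<exists>q. \<forall>\<^sub>F s in cofinite. composite_morphism V \<phi> \<pi> (cpt s) = q"
    and g: "morphism V (PS 2) (composite_morphism V (inv_into UNIV \<phi>) \<pi>)"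
      "\<exists>q. \<forall>\<^sub>F s in cofinite. composite_morphism V (inv_into UNIV \<phi>) \<pi> (cpt s) = q"
    and ample: "D_class \<phi> \<alpha> \<pi> V \<in> ample_cone V"
  shows "\<alpha> < 0"
proof -
  let ?w = "Poly_Mapping.single (pullback_hyperplane_class V 2 (composite_morphism V \<phi> \<pi>)) 1
     + Poly_Mapping.single (pullback_hyperplane_class V 2 (composite_morphism V (inv_into UNIV \<phi>) \<pi>)) 1
     - Poly_Mapping.single (pullback_hyperplane_class V 2 \<pi>) \<alpha>"
  let ?\<delta> = "class_degree (pullback_hyperplane_class V 2 \<pi>)"
  obtain v where v: "real_tensor_class (Pic V) v = real_tensor_class (Pic V) ?w" "v \<noteq> 0"
      "\<forall>A\<in>Poly_Mapping.keys v. ample_class V A \<and> Poly_Mapping.lookup v A > 0"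
    using ample unfolding ample_cone_def D_class_def by auto
  have "\<not> (\<forall>\<^sub>F s in cofinite. cpt s = q)" for q
  proof
    assume "\<forall>\<^sub>F s in cofinite. cpt s = q"
    then have "\<forall>\<^sub>F s in cofinite. \<pi> (cpt s) = \<pi> q" by eventually_elim simp
    then show False using \<pi>_cpt_not_constant[OF \<pi>] by blast
  qed
  then have "class_degree A > 0" if "A \<in> Poly_Mapping.keys v" for A
    using ample_class_degree_pos v(3) that by blast
  then have "real_degree v > 0"
    unfolding real_degree_def using v(2,3) by (intro sum_pos) auto
  \<comment> \<open>The degree is read off twice: from a positive combination of ample classes, and
    from the definition of the divisor class.\<close>
  also have "real_degree v = real_degree ?w"
    by (rule real_tensor_class_degree[OF v(1)]) (use v(3) in \<open>auto simp: ample_class_def\<close>)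
  also have "\<dots> = - \<alpha> * ?\<delta>"
    using degree_pullback_hyperplane(2)[OF f(1)] degree_pullback_hyperplane(2)[OF g(1)] f(2) g(2)
    by (simp add: real_degree_add real_degree_diff real_degree_single)
  finally have "\<alpha> * ?\<delta> < 0" by simp
  \<comment> \<open>With the product strictly negative, this sign already forces the degree of the
    pullback along \<pi> to be positive and \<alpha> to be negative.\<close>
  moreover have "?\<delta> \<ge> 0" by (rule degree_pullback_hyperplane(1)[OF \<pi>])
  ultimately show ?thesis by (auto simp: mult_less_0_iff)
qed

end

theorem mainTheorem1:
  fixes P :: "mpoly \<times> mpoly" and d :: nat
  assumes "P \<in> Aut_A2"
    and "algebraic_degree P = d"
    and "d \<ge> 2"
  shows "ample_index (polynomial_map P) \<le> 0"
proof -
  obtain Q where P: "bivariate_pair P" and Q: "bivariate_pair Q"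
    and QP: "polynomial_map Q \<circ> polynomial_map P = id" and PQ: "polynomial_map P \<circ> polynomial_map Q = id"
    using assms(1) by (auto simp: Aut_A2_def)
  have inv: "inv_into UNIV (polynomial_map P) = polynomial_map Q"
    using inv_unique_comp[OF PQ QP] .
  have e: "algebraic_degree Q > 0" by (rule algebraic_degree_pos[OF QP])
  then have de: "algebraic_degree P * algebraic_degree Q \<ge> 2"
    using assms(2,3) mult_le_mono[of 2 d 1 "algebraic_degree Q"] by simp
  have "\<alpha> \<le> 0" if res: "resolution (polynomial_map P) \<pi> V"
    and ample: "D_class (polynomial_map P) \<alpha> \<pi> V \<in> ample_cone V" for \<alpha> \<pi> V
  proof -
    have bir: "birational_morphism V (PS 2) \<pi>" and var: "projective_variety V"
      and ex: "\<exists>f. represents_composite V (polynomial_map P) \<pi> f"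
        "\<exists>f. represents_composite V (polynomial_map Q) \<pi> f"
      using res unfolding resolution_def smooth_projective_variety_def inv by blast+
    obtain N where N: "V \<subseteq> PS N" using var unfolding projective_variety_def by blast
    have closed: "closedin zariski V" using var unfolding projective_variety_def by blast
    obtain p e B c H where "lifted_line V p e \<pi> B c H"
      using lifted_line_exists[OF bir N closed] by blast
    then interpret lifted_line V p e \<pi> B c H .
    have rep: "represents_composite V (polynomial_map P) \<pi> (composite_morphism V (polynomial_map P) \<pi>)"
        "represents_composite V (polynomial_map Q) \<pi> (composite_morphism V (polynomial_map Q) \<pi>)"
      unfolding composite_morphism_def using someI_ex[OF ex(1)] someI_ex[OF ex(2)] .
    \<comment> \<open>Strict for every single \<alpha>; passing to the two suprema leaves the weak
      inequality, and an empty set contributes minus infinity.\<close>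
    have "\<alpha> < 0"
    proof (rule ample_D_class_negative[OF _ _ _ _ _ ample])
      show "morphism V (PS 2) \<pi>" using bir unfolding birational_morphism_def by blast
      show "morphism V (PS 2) (composite_morphism V (polynomial_map P) \<pi>)"
        "morphism V (PS 2) (composite_morphism V (inv_into UNIV (polynomial_map P)) \<pi>)"
        unfolding inv using rep unfolding represents_composite_def by blast+
      show "\<exists>q. \<forall>\<^sub>F s in cofinite. composite_morphism V (polynomial_map P) \<pi> (cpt s) = q"
        by (rule automorphism_contracts_line[OF P Q QP refl refl de rep(1)])
      show "\<exists>q. \<forall>\<^sub>F s in cofinite. composite_morphism V (inv_into UNIV (polynomial_map P)) \<pi> (cpt s) = q"
        \<comment> \<open>The contraction argument is symmetric in an automorphism and its inverse,
          since only the product of the two degrees enters.\<close>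
        unfolding inv using automorphism_contracts_line[OF Q P PQ refl refl _ rep(2)] de by (simp add: mult.commute)
    qed
    then show ?thesis by simp
  qed
  then have "alpha_max_amp (polynomial_map P) \<pi> V \<le> 0" if "resolution (polynomial_map P) \<pi> V" for \<pi> V
    unfolding alpha_max_amp_def using that by (intro Sup_least) auto
  then show ?thesis
    unfolding ample_index_def by (intro Sup_least) auto
qed

end
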